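(* Let $L_\infty$ be the mixed labyrinth fractal generated by the sequence $\{\mathcal{A}_k\}_{k\ge 1}$, where $\mathcal{A}_k$ is the $k$-th snake cross pattern. Then, for any distinct points $x,y\in L_\infty$, the arc $a(x,y)$ that connects $x$ and $y$ in $L_\infty$ has box counting dimension $\dim_B(a(x,y))=2$.
   Context: **Patterns and limit sets.** For $m\ge1$ and $0\le i,j\le m-1$ let $S_{i,j,m}=[\frac im,\frac{i+1}m]\times[\frac jm,\frac{j+1}m]$ (column $i$, row $j$) and $\mathcal{S}_m=\{S_{i,j,m}: 0\le i,j\le m-1\}$. A nonempty $\mathcal{A}\subseteq\mathcal{S}_m$ is an $m$-pattern of width $m$; its elements are called white squares. For a square $Q=[x,x+q]\times[y,y+q]\subseteq[0,1]^2$ let $P_Q(z_x,z_y)=(qz_x+x,qz_y+y)$. Given a sequence of patterns $\{\mathcal{A}_k\}_{k\ge1}$ of widths $m_k$, put $m(n)=\prod_{k=1}^n m_k$, $\mathcal{W}_1=\mathcal{A}_1$, and $\mathcal{W}_n=\{P_{W'}(W): W\in\mathcal{A}_n, W'\in\mathcal{W}_{n-1}\}\subseteq\mathcal{S}_{m(n)}$ for $n\ge2$ (white squares of level $n$); $L_n=\bigcup_{W\in\mathcal{W}_n}W$ and $L_\infty=\bigcap_{n\ge1}L_n$. **Labyrinth patterns.** The graph $\mathcal{G}(\mathcal{A})$ has the white squares of $\mathcal{A}$ as vertices, two being adjacent iff they share a common side. A vertical exit pair of $\mathcal{A}$ consists of two white squares in the same column, one in the top row (the top exit), the other in the bottom row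 (the bottom exit); a horizontal exit pair (left exit, right exit) consists of two white squares in the same row, one in the left and one in the right column. An $m$-pattern with $m\ge3$ is a labyrinth pattern if: (1) $\mathcal{G}(\mathcal{A})$ is a tree; (2) $\mathcal{A}$ has exactly one vertical and exactly one horizontal exit pair; (3) if a corner square of the $m\times m$ grid is white, then the diagonally opposite corner square is not white. If all $\mathcal{A}_k$ are labyrinth patterns, $L_\infty$ is called a mixed labyrinth fractal. It is known that such an $L_\infty$ is a dendrite, so any two distinct points of $L_\infty$ are connected by a unique arc in $L_\infty$. **Snake cross patterns.** For $k\ge1$ the $k$-th snake cross pattern $\mathcal{A}_k$ has width $m_k=4k+7$. Denote by $(x,y)$ (integers, $|x|,|y|\le 2k+3$) the square $S_{2k+3+x,\,2k+3+y,\,4k+7}$, so $(0,0)$ is the central square. Put $x_0=0$ and $x_j=(-1)^{j+1}(2j-1)$ for $1\le j\le k$. The top arm consists of the squares: $(0,1),(0,2)$; for each $j=1,\dots,k$, all $(x,2j)$ with $x$ between $x_{j-1}$ and $x_j$ (inclusive), and $(x_j,2j+1),(x_j,2j+2)$; all $(x,2k+2)$ with $x$ between $0$ and $x_k$ (inclusive); and $(0,2k+3)$. The white squares of $\mathcal{A}_k$ are the central square, the top arm, and the images of the top arm under rotation by $90^\circ,180^\circ,270^\circ$ about the central square. *)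

theory Defs
  imports "HOL-Analysis.Analysis"
begin

definition cell :: "int \<Rightarrow> int \<Rightarrow> nat \<Rightarrow> (real \<times> real) set" where
  "cell i j m =
     {of_int i / real m .. (of_int i + 1) / real m} \<times>
     {of_int j / real m .. (of_int j + 1) / real m}"

definition square :: "real \<Rightarrow> real \<Rightarrow> real \<Rightarrow> (real \<times> real) set" where
  "square x y q = {x .. x + q} \<times> {y .. y + q}"

text \<open>The map \<open>P\<^sub>Q\<close> for \<open>Q = square x y q\<close>; it sends the unit square onto \<open>Q\<close>.\<close>

definition square_map :: "real \<Rightarrow> real \<Rightarrow> real \<Rightarrow> real \<times> real \<Rightarrow> real \<times> real" where
  "square_map x y q z = (q * fst z + x, q * snd z + y)"

text \<open>
  A pattern is a set of squares (its white squares), each square being a set of points.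
  Sequences of patterns are indexed from 1, so the value \<open>A 0\<close> is never used.
  Taking the unit square as the only white square of level 0 makes the set of white
  squares of level 1 equal to \<open>A 1\<close>.
\<close>

fun white_squares ::
  "(nat \<Rightarrow> (real \<times> real) set set) \<Rightarrow> nat \<Rightarrow> (real \<times> real) set set" where
  "white_squares A 0 = {square 0 0 1}"
| "white_squares A (Suc n) =
     {square_map x y q ` W | x y q W.
        q > 0 \<and> square x y q \<in> white_squares A n \<and> W \<in> A (Suc n)}"

definition limit_set :: "(nat \<Rightarrow> (real \<times> real) set set) \<Rightarrow> (real \<times> real) set" where
  "limit_set A = (\<Inter>n\<in>{1..}. \<Union>(white_squares A n))"

definition snake_x :: "nat \<Rightarrow> int" where
  "snake_x j = (if j = 0 then 0 else (- 1) ^ (j + 1) * (2 * int j - 1))"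

definition between_int :: "int \<Rightarrow> int \<Rightarrow> int set" where
  "between_int a b = {min a b .. max a b}"

text \<open>
  The cells of a snake cross are given by integer coordinates relative to the central cell.
\<close>

definition top_arm :: "nat \<Rightarrow> (int \<times> int) set" where
  "top_arm k =
     {(0, 1), (0, 2)} \<union>
     (\<Union>j\<in>{1..k}.
        between_int (snake_x (j - 1)) (snake_x j) \<times> {2 * int j} \<union>
        {(snake_x j, 2 * int j + 1), (snake_x j, 2 * int j + 2)}) \<union>
     between_int 0 (snake_x k) \<times> {2 * int k + 2} \<union>
     {(0, 2 * int k + 3)}"

definition rotate_90 :: "int \<times> int \<Rightarrow> int \<times> int" where
  "rotate_90 p = (- snd p, fst p)"

definition snake_cells :: "nat \<Rightarrow> (int \<times> int) set" where
  "snake_cells k = {(0, 0)} \<union> (\<Union>r\<in>{0..3}. (rotate_90 ^^ r) ` top_arm k)"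

definition snake_cross :: "nat \<Rightarrow> (real \<times> real) set set" where
  "snake_cross k =
     {cell (2 * int k + 3 + x) (2 * int k + 3 + y) (4 * k + 7) | x y. (x, y) \<in> snake_cells k}"

definition arc_between :: "'a::topological_space set \<Rightarrow> 'a \<Rightarrow> 'a \<Rightarrow> 'a set \<Rightarrow> bool" where
  "arc_between L x y a \<longleftrightarrow>
     (\<exists>g. arc g \<and> pathstart g = x \<and> pathfinish g = y \<and> path_image g = a \<and> a \<subseteq> L)"

text \<open>
  The least number of sets of diameter at most \<open>\<delta>\<close> that cover \<open>F\<close>.  Boundedness is required
  explicitly because \<^const>\<open>diameter\<close> is meaningless on unbounded sets.  The number is
  well defined for \<open>\<delta> > 0\<close> and totally bounded \<open>F\<close>.
\<close>

definition covering_number :: "real \<Rightarrow> 'a::metric_space set \<Rightarrow> nat" where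
  "covering_number \<delta> F =
     (LEAST n. \<exists>C. finite C \<and> card C = n \<and> F \<subseteq> \<Union>C \<and>
        (\<forall>U\<in>C. bounded U \<and> diameter U \<le> \<delta>))"

text \<open>
  The limit exists with value \<open>d\<close> iff the lower and upper box counting dimensions
  are both equal to \<open>d\<close>.
\<close>

definition has_box_dim :: "'a::metric_space set \<Rightarrow> real \<Rightarrow> bool" where
  "has_box_dim F d \<longleftrightarrow>
     ((\<lambda>\<delta>. ln (real (covering_number \<delta> F)) / - ln \<delta>) \<longlongrightarrow> d) (at_right 0)"

end

theory Submission
  imports Defs "HOL-Real_Asymp.Real_Asymp"
begin

text \<open>
  The conclusion holds for every connected subset \<open>C\<close> of the limit set with two points.  Planar sets
  have box dimension at most 2, so what matters is that \<open>C\<close> visits very many small squares.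

  All exits of a snake cross are midpoints of the sides of the unit square, so the fractal inside a
  white square meets the boundary of that square only in the four midpoints of its sides, and two
  white squares of the same level share at most one point of the fractal.  As each pattern is a
  tree, such a shared point cuts the fractal.  A connected set that lies on two sides of a cut
  therefore contains the cut point, and its parts on each side remain connected (\<open>connected_cut\<close>).
  Two consequences carry the proof.

  Suppose that \<open>C\<close> contains two exits of a white square: it crosses the square.  One of the two
  exits belongs to an arm, and every cell in the interior of a row of that arm (after rotating it to the
  top) lies between two cuts that separate the exits, so \<open>C\<close> crosses this cell from left to right
  (\<open>crossing_straight_cell\<close>).  In the pattern of width \<open>4 * n + 11\<close> there are at least \<open>n\<^sup>2\<close> such cells
  with two even coordinates; being at distance at least one cell from each other, they yield points far
  apart.  Iterating from level \<open>n\<close>, a crossing contains \<open>(\<Prod>i<d. (n + i)\<^sup>2)\<close> points at mutual distance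
  at least the side length of the squares \<open>d\<close> levels below (\<open>crossing_separated\<close>).

  Conversely every connected \<open>C\<close> with two points crosses some white square (\<open>connected_plump\<close>).
  Zoom into white squares as long as \<open>C\<close> lies in one of them; zooming enlarges distances, so this
  stops.  Then, among the cells of a smallest cover of \<open>C\<close>, an outermost one has a single neighbour
  in the cover, and \<open>C\<close> enters it through an exit and reaches another point of it.  Zooming
  further towards that exit until \<open>C\<close> leaves the square again produces a crossing.

  The squares of level \<open>n\<close> have side length at least \<open>1 / (11 ^ n * fact n)\<close>, and \<open>C\<close> cannot be
  covered by fewer than a constant times \<open>(fact (n - 1))\<^sup>2\<close> sets of smaller diameter.
  As \<open>ln (fact n)\<close> grows like \<open>n * ln n\<close>, the factors \<open>11 ^ n\<close> and the gap between consecutive scales do not matter for the quotient of logarithms, which tends to 2.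
\<close>

section \<open>The cells of a snake cross\<close>

text \<open>
  Row \<open>2 * j\<close> of the top arm is traversed from \<open>snake_x (j - 1)\<close> to \<open>snake_x j\<close>, in the direction
  \<open>turn j\<close>.  Multiplying abscissas by \<open>turn j\<close> makes all even rows run from left to right.
\<close>

definition turn :: "nat \<Rightarrow> int" where
  "turn j = (- 1) ^ (j + 1)"

lemma turn_cases: "turn j = 1 \<or> turn j = - 1"
  unfolding turn_def by (cases "even j") auto

lemma turn_Suc: "turn (Suc j) = - turn j"
  by (simp add: turn_def)

lemma turn_mult_snake_x: "turn j * snake_x j = (if j = 0 then 0 else 2 * int j - 1)"
  by (simp add: turn_def snake_x_def flip: mult.assoc power_add)

lemma turn_mult_snake_x_pred:
  assumes "j \<ge> 1"
  shows "turn j * snake_x (j - 1) = (if j = 1 then 0 else - (2 * int j - 3))"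
proof -
  obtain i where j: "j = Suc i"
    using assms by (cases j) auto
  show ?thesis
    using turn_mult_snake_x[of i] by (auto simp: j turn_Suc)
qed

text \<open>
  Necessary conditions for a cell of the top arm in row \<open>2 * j\<close> and in row \<open>2 * j + 1\<close>.  The row
  \<open>2 * k + 2\<close> is treated like the others although it stops halfway at abscissa 0, and the cells
  \<open>(0, 1)\<close> and \<open>(0, 2 * k + 3)\<close> are the odd rows with \<open>j = 0\<close> and \<open>j = k + 1\<close>.
\<close>

definition even_row :: "nat \<Rightarrow> int \<Rightarrow> int \<Rightarrow> nat \<Rightarrow> bool" where
  "even_row k x y j \<longleftrightarrow>
     1 \<le> j \<and> j \<le> k + 1 \<and> y = 2 * int j \<and>
     (if j = 1 then 0 else - (2 * int j - 3)) \<le> turn j * x \<and> turn j * x \<le> 2 * int j - 1"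

definition odd_row :: "nat \<Rightarrow> int \<Rightarrow> int \<Rightarrow> nat \<Rightarrow> bool" where
  "odd_row k x y j \<longleftrightarrow>
     j \<le> k + 1 \<and> y = 2 * int j + 1 \<and>
     turn j * x = (if j = 0 \<or> j = k + 1 then 0 else 2 * int j - 1)"

lemma turn_mult_between:
  assumes "x \<in> between_int a b"
  shows "min (turn j * a) (turn j * b) \<le> turn j * x \<and> turn j * x \<le> max (turn j * a) (turn j * b)"
  using assms turn_cases[of j] by (auto simp: between_int_def)

lemma top_arm_rows:
  assumes "(x, y) \<in> top_arm k" "k \<ge> 1"
  shows "(\<exists>j. even_row k x y j) \<or> (\<exists>j. odd_row k x y j)"
proof -
  consider "x = 0" "y = 1" | "x = 0" "y = 2"
    | j where "1 \<le> j" "j \<le> k" "x \<in> between_int (snake_x (j - 1)) (snake_x j)" "y = 2 * int j"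
    | j where "1 \<le> j" "j \<le> k" "x = snake_x j" "y = 2 * int j + 1"
    | j where "1 \<le> j" "j \<le> k" "x = snake_x j" "y = 2 * int j + 2"
    | "x \<in> between_int 0 (snake_x k)" "y = 2 * int k + 2"
    | "x = 0" "y = 2 * int k + 3"
    using assms unfolding top_arm_def by auto
  then show ?thesis
  proof cases
    case 1
    then have "odd_row k x y 0" by (simp add: odd_row_def)
    then show ?thesis by blast
  next
    case 2
    then have "even_row k x y 1" by (simp add: even_row_def)
    then show ?thesis by blast
  next
    case (3 j)
    have "even_row k x y j"
      using 3 turn_mult_between[OF 3(3), of j] turn_mult_snake_x_pred[of j] turn_mult_snake_x[of j]
      unfolding even_row_def by (auto split: if_splits)
    then show ?thesis by blast
  next
    case (4 j)
    have "odd_row k x y j"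
      using 4 turn_mult_snake_x[of j] unfolding odd_row_def by auto
    then show ?thesis by blast
  next
    case (5 j)
    have "even_row k x y (Suc j)"
      using 5 turn_mult_snake_x[of j] turn_Suc[of j] unfolding even_row_def by auto
    then show ?thesis by blast
  next
    case 6
    have "even_row k x y (Suc k)"
      using assms 6(2) turn_mult_between[OF 6(1), of "Suc k"] turn_mult_snake_x[of k] turn_Suc[of k]
      unfolding even_row_def by auto
    then show ?thesis by blast
  next
    case 7
    have "odd_row k x y (Suc k)"
      using 7 unfolding odd_row_def by auto
    then show ?thesis by blast
  qed
qed

lemma even_row_abs_less: "even_row k x y j \<Longrightarrow> \<bar>x\<bar> < y \<and> y \<le> 2 * int k + 2"
  using turn_cases[of j] unfolding even_row_def by (auto split: if_splits)

lemma odd_row_abs_less: "odd_row k x y j \<Longrightarrow> \<bar>x\<bar> < y \<and> y \<le> 2 * int k + 3"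
  using turn_cases[of j] unfolding odd_row_def by (auto split: if_splits)

lemma top_arm_abs_less:
  assumes "(x, y) \<in> top_arm k" "k \<ge> 1"
  shows "\<bar>x\<bar> < y \<and> y \<le> 2 * int k + 3"
  using top_arm_rows[OF assms] even_row_abs_less odd_row_abs_less by fastforce

lemma snake_cells_iff:
  "(x, y) \<in> snake_cells k \<longleftrightarrow>
     (x, y) = (0, 0) \<or> (x, y) \<in> top_arm k \<or> (y, - x) \<in> top_arm k \<or>
     (- x, - y) \<in> top_arm k \<or> (- y, x) \<in> top_arm k"
proof -
  have *: "{0..3::nat} = {0, 1, 2, 3}" by auto
  have inj: "p \<in> rotate_90 ` B \<longleftrightarrow> (snd p, - fst p) \<in> B" for p B
    by (force simp: rotate_90_def image_iff)
  have iter: "(rotate_90 ^^ 2) ` B = rotate_90 ` rotate_90 ` B"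
    "(rotate_90 ^^ 3) ` B = rotate_90 ` rotate_90 ` rotate_90 ` B" for B
    by (auto simp: numeral_2_eq_2 numeral_3_eq_3 image_comp o_def)
  show ?thesis
    unfolding snake_cells_def * by (simp add: iter inj)
qed

lemma rotate_90_snake_cells: "c \<in> snake_cells k \<Longrightarrow> rotate_90 c \<in> snake_cells k"
  by (cases c) (auto simp: rotate_90_def snake_cells_iff)

lemma snake_cells_abs_le:
  assumes "(x, y) \<in> snake_cells k" "k \<ge> 1"
  shows "\<bar>x\<bar> \<le> 2 * int k + 3 \<and> \<bar>y\<bar> \<le> 2 * int k + 3"
  using assms(1) top_arm_abs_less[OF _ assms(2)] unfolding snake_cells_iff by fastforce

lemma snake_cells_le: "(x, y) \<in> snake_cells (Suc n) \<Longrightarrow> x \<le> 2 * int n + 5 \<and> y \<le> 2 * int n + 5"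
  using snake_cells_abs_le[of x y "Suc n"] by (auto dest: abs_le_D1)

text \<open>
  The four arms lie in the four open sectors cut out by the diagonals.  This is what keeps them apart:
  cells in different sectors never share a side (\<open>adjacent_sector\<close> below).
\<close>

lemma snake_cells_sector:
  assumes "(x, y) \<in> snake_cells k" "k \<ge> 1"
  shows "(x, y) = (0, 0) \<or> \<bar>x\<bar> < y \<or> \<bar>x\<bar> < - y \<or> \<bar>y\<bar> < x \<or> \<bar>y\<bar> < - x"
  using assms(1) top_arm_abs_less[OF _ assms(2)] unfolding snake_cells_iff by fastforce

lemma snake_cells_top:
  assumes "(x, y) \<in> snake_cells k" "k \<ge> 1" "\<bar>x\<bar> < y"
  shows "(x, y) \<in> top_arm k"
  using assms(1,3) top_arm_abs_less[OF _ assms(2)] unfolding snake_cells_iff by fastforce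

lemma finite_snake_cells: "k \<ge> 1 \<Longrightarrow> finite (snake_cells k)"
  by (rule finite_subset[of _ "{- (2 * int k + 3)..2 * int k + 3} \<times> {- (2 * int k + 3)..2 * int k + 3}"])
    (use snake_cells_abs_le in \<open>force simp: abs_le_iff\<close>, simp)

lemma snake_cells_top_row:
  assumes "(x, 2 * int k + 3) \<in> snake_cells k" "k \<ge> 1"
  shows "x = 0"
proof -
  have "\<bar>x\<bar> < 2 * int k + 3"
    using snake_cells_sector[OF assms] snake_cells_abs_le[OF assms] by auto
  then have "(x, 2 * int k + 3) \<in> top_arm k"
    using snake_cells_top assms by blast
  from top_arm_rows[OF this assms(2)] show ?thesis
  proof (elim disjE exE)
    fix j assume "even_row k x (2 * int k + 3) j"
    then show ?thesis by (auto simp: even_row_def)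
  next
    fix j assume *: "odd_row k x (2 * int k + 3) j"
    then have "j = k + 1" by (auto simp: odd_row_def)
    with * show ?thesis
      using turn_cases[of j] by (auto simp: odd_row_def)
  qed
qed

lemma even_row_memD:
  assumes "(x, 2 * int j) \<in> top_arm k" "k \<ge> 1"
  shows "even_row k x (2 * int j) j"
  using top_arm_rows[OF assms]
proof (elim disjE exE)
  fix i assume i: "even_row k x (2 * int j) i"
  then have "i = j" by (simp add: even_row_def)
  then show ?thesis using i by simp
next
  fix i assume "odd_row k x (2 * int j) i"
  then have "2 * int j = 2 * int i + 1" by (simp add: odd_row_def)
  then have False by presburger
  then show ?thesis ..
qed

lemma odd_row_memD:
  assumes "(x, 2 * int j + 1) \<in> top_arm k" "k \<ge> 1"
  shows "odd_row k x (2 * int j + 1) j"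
  using top_arm_rows[OF assms]
proof (elim disjE exE)
  fix i assume "even_row k x (2 * int j + 1) i"
  then have "2 * int j + 1 = 2 * int i" by (simp add: even_row_def)
  then have False by presburger
  then show ?thesis ..
next
  fix i assume i: "odd_row k x (2 * int j + 1) i"
  then have "i = j" by (simp add: odd_row_def)
  then show ?thesis using i by simp
qed

definition adjacent :: "int \<times> int \<Rightarrow> int \<times> int \<Rightarrow> bool" where
  "adjacent u v \<longleftrightarrow> \<bar>fst u - fst v\<bar> + \<bar>snd u - snd v\<bar> = 1"

lemma adjacent_sector:
  assumes "(x, y) \<in> snake_cells k" "k \<ge> 1" "\<bar>x'\<bar> < y'" "adjacent (x', y') (x, y)"
  shows "(x, y) = (0, 0) \<or> \<bar>x\<bar> < y"
  using snake_cells_sector[OF assms(1,2)] assms(3,4) unfolding adjacent_def fst_conv snd_conv by linarith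

lemma adjacent_cases:
  assumes "adjacent (x, y) v"
  shows "v = (x + 1, y) \<or> v = (x - 1, y) \<or> v = (x, y + 1) \<or> v = (x, y - 1)"
proof (cases v)
  case (Pair a b)
  then show ?thesis using assms unfolding adjacent_def fst_conv snd_conv by auto
qed

text \<open>
  The part of the top arm that is cut off when row \<open>2 * j\<close> is interrupted just before the cell whose
  abscissa times \<open>turn j\<close> is \<open>t\<close>.
\<close>

definition outer :: "nat \<Rightarrow> nat \<Rightarrow> int \<Rightarrow> (int \<times> int) set" where
  "outer k j t =
     {(x, y) \<in> snake_cells k. \<bar>x\<bar> < y \<and> (y > 2 * int j \<or> y = 2 * int j \<and> turn j * x \<ge> t)}"

text \<open>
  The arm is a path, so a single side joins its outer part to all the other cells.  Contacts between
  different even rows are excluded because the odd rows consist of one cell each, placed where the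
  lower row ends and the upper row begins.
\<close>

lemma outer_adjacent:
  assumes k: "k \<ge> 1" and j: "2 \<le> j" "j \<le> k" and t: "- (2 * int j - 3) < t" "t \<le> 2 * int j - 1"
    and u: "u \<in> outer k j t" and v: "v \<in> snake_cells k" "v \<notin> outer k j t" and adj: "adjacent u v"
  shows "u = (turn j * t, 2 * int j) \<and> v = (turn j * (t - 1), 2 * int j)"
proof -
  obtain x y where uxy: "u = (x, y)" by (cases u)
  obtain x' y' where vxy: "v = (x', y')" by (cases v)
  have y: "\<bar>x\<bar> < y" "y > 2 * int j \<or> y = 2 * int j \<and> turn j * x \<ge> t" "(x, y) \<in> top_arm k"
    using u snake_cells_top k by (auto simp: uxy outer_def)
  have "v \<noteq> (0, 0)"
    using y j adj by (auto simp: uxy adjacent_def)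
  then have v_top: "\<bar>x'\<bar> < y'" "(x', y') \<in> top_arm k"
    using adjacent_sector[of x' y' k x y] v k y(1) adj snake_cells_top[of x' y' k] by (auto simp: uxy vxy)
  have v_out: "y' < 2 * int j \<or> y' = 2 * int j \<and> turn j * x' < t"
    using v v_top by (auto simp: vxy outer_def)
  consider "x' = x + 1" "y' = y" | "x' = x - 1" "y' = y" | "x' = x" "y' = y + 1" | "x' = x" "y' = y - 1"
    using adjacent_cases[of x y v] adj by (auto simp: uxy vxy)
  then show ?thesis
  proof cases
    case 1
    then show ?thesis using y(2) v_out turn_cases[of j] by (auto simp: uxy vxy)
  next
    case 2
    then show ?thesis using y(2) v_out turn_cases[of j] by (auto simp: uxy vxy)
  next
    case 3
    then show ?thesis using y(2) v_out by auto
  next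
    case 4
    show ?thesis
    proof (cases "y = 2 * int j")
      case True
      obtain i where i: "j = Suc i" "i \<ge> 1" using j by (cases j) auto
      have "y' = 2 * int i + 1" using True 4 i by simp
      then have "odd_row k x y' i" using v_top(2) odd_row_memD[of x i k] k 4 by (simp only:)
      then have "turn i * x = 2 * int i - 1" using i j by (auto simp: odd_row_def)
      then show ?thesis using True y(2) t i by (auto simp: turn_Suc)
    next
      case False
      then have "y = 2 * int j + 1" "turn j * x < t" using 4 y(2) v_out by auto
      then have "odd_row k x y j" using y(3) odd_row_memD[of x j k] k by simp
      then show ?thesis using j t \<open>turn j * x < t\<close> by (auto simp: odd_row_def)
    qed
  qed
qed

text \<open>
  The arm is traversed row by row, and each even row in the direction \<open>turn\<close>.  Hence the two possible
  predecessors of a cell, below it and behind it in its row, are not both white: only the first cell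
  of a row has a white cell below, and nothing of the row lies behind it.
\<close>

lemma lower_neighbours_unique:
  assumes k: "k \<ge> 1" and "(x, y) \<in> snake_cells k" "\<bar>x\<bar> < y"
    and "(x, y - 1) \<in> snake_cells k"
  shows "(x - turn (nat (y div 2)), y) \<notin> snake_cells k"
proof
  let ?x = "x - turn (nat (y div 2))"
  assume a: "(?x, y) \<in> snake_cells k"
  have xy: "(x, y) \<in> top_arm k" using assms snake_cells_top by blast
  have bl: "(x, y - 1) = (0, 0) \<or> \<bar>x\<bar> < y - 1"
    using adjacent_sector[of x "y - 1" k x y] assms by (auto simp: adjacent_def)
  have "(?x, y) = (0, 0) \<or> \<bar>?x\<bar> < y"
    using adjacent_sector[of ?x y k x y] a assms turn_cases[of "nat (y div 2)"]
    by (auto simp: adjacent_def)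
  then have x': "(?x, y) \<in> top_arm k" 
    using a snake_cells_top[of ?x y k] k assms(3) by auto
  from top_arm_rows[OF xy k] show False
  proof (elim disjE exE)
    fix j assume *: "even_row k x y j"
    then obtain i where i: "j = Suc i" "y = 2 * int j" by (cases j) (auto simp: even_row_def)
    have j: "nat (y div 2) = j" using i by simp
    have "even_row k ?x y j" using even_row_memD[of ?x j k] x' i k by simp
    moreover have "turn j * ?x = turn j * x - 1"
      using turn_cases[of j] by (auto simp: j algebra_simps)
    moreover have "odd_row k x (y - 1) i"
    proof -
      have "y \<noteq> 1" using i(2) by presburger
      then have "(x, y - 1) \<in> top_arm k"
        using bl i(2) snake_cells_top[OF assms(4) k] by auto
      moreover have "y - 1 = 2 * int i + 1" using i by simp
      ultimately show ?thesis using odd_row_memD[of x i k] k by (simp only:)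
    qed
    ultimately show False
      using * i by (auto simp: even_row_def odd_row_def turn_Suc split: if_splits)
  next
    fix j assume *: "odd_row k x y j"
    then have j: "nat (y div 2) = j" "y = 2 * int j + 1" by (auto simp: odd_row_def)
    have "odd_row k ?x y j" using odd_row_memD[of ?x j k] x' j k by simp
    then show False
      using * turn_cases[of j] by (auto simp: odd_row_def j(1) algebra_simps)
  qed
qed

section \<open>The fractal in centred coordinates\<close>

text \<open>
  Both the unit square and the cells are centred at the origin, which makes rotations linear.  The
  parameter \<open>n\<close> is the number of patterns already used, so the next pattern is \<open>snake_cross (n + 1)\<close>,
  of width \<open>4 * n + 11\<close>.  The set \<open>fractal n\<close> is the limit set of the patterns with indices greater
  than \<open>n\<close>, and \<open>emb n c\<close> places a copy of \<open>fractal (n + 1)\<close> in the cell \<open>c\<close>.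
\<close>

definition emb :: "nat \<Rightarrow> int \<times> int \<Rightarrow> real \<times> real \<Rightarrow> real \<times> real" where
  "emb n c w = (1 / (4 * real n + 11)) *\<^sub>R ((of_int (fst c), of_int (snd c)) + w)"

definition unit_box :: "(real \<times> real) set" where
  "unit_box = {- 1/2..1/2} \<times> {- 1/2..1/2}"

primrec approx :: "nat \<Rightarrow> nat \<Rightarrow> (real \<times> real) set" where
  "approx 0 n = unit_box"
| "approx (Suc d) n = (\<Union>c\<in>snake_cells (Suc n). emb n c ` approx d (Suc n))"

definition fractal :: "nat \<Rightarrow> (real \<times> real) set" where
  "fractal n = (\<Inter>d. approx d n)"

definition rot :: "real \<times> real \<Rightarrow> real \<times> real" where
  "rot p = (- snd p, fst p)"

lemma emb_inj: "emb n c w = emb n c w' \<longleftrightarrow> w = w'"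
  by (simp add: emb_def)

lemma dist_emb: "dist (emb n c w) (emb n c w') = dist w w' / (4 * real n + 11)"
  by (simp add: emb_def dist_norm flip: scaleR_diff_right)

lemma fst_emb: "fst (emb n c w) = (of_int (fst c) + fst w) / (4 * real n + 11)"
  and snd_emb: "snd (emb n c w) = (of_int (snd c) + snd w) / (4 * real n + 11)"
  by (simp_all add: emb_def)

lemma emb_coord_eq: "(x::real) / (4 * real n + 11) = y \<longleftrightarrow> x = y * (4 * real n + 11)"
  by (simp add: divide_eq_eq)

lemma continuous_on_emb: "continuous_on S (emb n c)"
  unfolding emb_def by (intro continuous_intros)

lemma mem_unit_box: "w \<in> unit_box \<longleftrightarrow> \<bar>fst w\<bar> \<le> 1/2 \<and> \<bar>snd w\<bar> \<le> 1/2"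
  by (cases w) (auto simp: unit_box_def abs_le_iff)

lemma emb_unit_box:
  assumes "c \<in> snake_cells (Suc n)" "w \<in> unit_box"
  shows "emb n c w \<in> unit_box"
proof -
  obtain i j where c: "c = (i, j)" by (cases c)
  have ij: "\<bar>i\<bar> \<le> 2 * int n + 5" "\<bar>j\<bar> \<le> 2 * int n + 5"
    using snake_cells_abs_le[of i j "Suc n"] assms(1) by (auto simp: c)
  have b: "\<bar>real_of_int i\<bar> \<le> 2 * real n + 5" if "\<bar>i\<bar> \<le> 2 * int n + 5" for i
    using that by linarith
  have "\<bar>(of_int i + x) / (4 * real n + 11)\<bar> \<le> 1/2" if "\<bar>i\<bar> \<le> 2 * int n + 5" "\<bar>x\<bar> \<le> 1/2" for i x
  proof -
    have "\<bar>of_int i + x\<bar> \<le> (4 * real n + 11) / 2" 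
      using b[OF that(1)] that(2) abs_triangle_ineq[of "of_int i" x] by (simp add: field_simps)
    then show ?thesis by (simp add: divide_le_eq)
  qed
  then show ?thesis
    using ij assms(2) by (simp add: mem_unit_box emb_def c)
qed

lemma approx_Suc_subset: "approx (Suc d) n \<subseteq> approx d n"
proof (induction d arbitrary: n)
  case 0
  then show ?case using emb_unit_box by auto
next
  case (Suc d)
  show ?case unfolding approx.simps(2)[of "Suc d"] 
    by (subst approx.simps(2)[of d]) (use Suc in blast)
qed

lemma approx_antimono: "d \<le> e \<Longrightarrow> approx e n \<subseteq> approx d n"
  by (rule lift_Suc_antimono_le[of "\<lambda>d. approx d n", OF approx_Suc_subset])

lemma fractal_subset_unit_box: "fractal n \<subseteq> unit_box"
  unfolding fractal_def using approx.simps(1)[of n] by blast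

lemma fractal_abs_le: "z \<in> fractal n \<Longrightarrow> \<bar>fst z\<bar> \<le> 1/2 \<and> \<bar>snd z\<bar> \<le> 1/2"
  using fractal_subset_unit_box mem_unit_box by blast

text \<open>
  The cell may depend on the level of the approximation, but there are only finitely many cells and
  the approximations decrease, so one cell serves all levels.
\<close>

lemma fractal_cases:
  assumes "z \<in> fractal n"
  obtains c w where "c \<in> snake_cells (Suc n)" "w \<in> fractal (Suc n)" "z = emb n c w"
proof (rule ccontr)
  assume neg: "\<not> thesis"
  note that_thesis = that
  let ?w = "\<lambda>c. (4 * real n + 11) *\<^sub>R z - (of_int (fst c), of_int (snd c))"
  have z: "z = emb n c w \<longleftrightarrow> w = ?w c" for c w
    by (auto simp: emb_def)
  have "\<exists>d. ?w c \<notin> approx d (Suc n)" if "c \<in> snake_cells (Suc n)" for c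
  proof (rule ccontr)
    assume "\<not> ?thesis"
    then have "?w c \<in> fractal (Suc n)" unfolding fractal_def by blast
    moreover have "z = emb n c (?w c)" using z by blast
    ultimately show False using neg \<open>c \<in> snake_cells (Suc n)\<close> that_thesis by blast
  qed
  then obtain d where d: "\<And>c. c \<in> snake_cells (Suc n) \<Longrightarrow> ?w c \<notin> approx (d c) (Suc n)"
    by metis
  define e where "e = Max (d ` snake_cells (Suc n))"
  have fin: "finite (snake_cells (Suc n))"
    using finite_snake_cells[of "Suc n"] by simp
  have e: "?w c \<notin> approx e (Suc n)" if "c \<in> snake_cells (Suc n)" for c
    using d[OF that] approx_antimono[of "d c" e "Suc n"] fin that by (auto simp: e_def)
  have "z \<in> approx (Suc e) n"
    using assms unfolding fractal_def by blast
  then obtain c w where "c \<in> snake_cells (Suc n)" "w \<in> approx e (Suc n)" "z = emb n c w"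
    by auto
  then show False using e[of c] z[of c w] by simp
qed

lemma compact_approx: "compact (approx d n)"
proof (induction d arbitrary: n)
  case 0
  then show ?case by (simp add: unit_box_def compact_Times)
next
  case (Suc d)
  then show ?case
    using finite_snake_cells[of "Suc n"] continuous_on_emb
    by (auto intro!: compact_UN compact_continuous_image)
qed

lemma compact_fractal: "compact (fractal n)"
proof -
  have "closed (fractal n)"
    unfolding fractal_def using compact_approx compact_imp_closed by (intro closed_INT) auto
  moreover have "bounded (fractal n)"
    using fractal_subset_unit_box bounded_subset[OF compact_imp_bounded[OF compact_approx[of 0 n]]] by simp
  ultimately show ?thesis by (simp add: compact_eq_bounded_closed)
qed

lemma rot_emb: "rot (emb n c w) = emb n (rotate_90 c) (rot w)"
  by (simp add: rot_def emb_def rotate_90_def diff_divide_distrib add_divide_distrib)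

lemma rot_approx: "z \<in> approx d n \<Longrightarrow> rot z \<in> approx d n"
proof (induction d arbitrary: n z)
  case 0
  then show ?case by (simp add: mem_unit_box rot_def)
next
  case (Suc d)
  then obtain c w where "c \<in> snake_cells (Suc n)" "w \<in> approx d (Suc n)" "z = emb n c w"
    by auto
  then show ?case
    using Suc.IH[of w] rotate_90_snake_cells[of c "Suc n"] by (auto simp: rot_emb)
qed

lemma rot_fractal: "z \<in> fractal n \<Longrightarrow> rot z \<in> fractal n"
  unfolding fractal_def using rot_approx by blast

text \<open>
  A point on the top side lies in the only white cell of the top row, again on the top side of that
  cell; each such step halves, at least, the bound on its distance from the vertical axis.
\<close>

lemma fractal_top_side_aux:
  assumes "z \<in> fractal n" "snd z = 1/2"
  shows "\<bar>fst z\<bar> \<le> (1/2) ^ d"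
  using assms
proof (induction d arbitrary: n z)
  case 0
  then show ?case using fractal_abs_le[of z n] by simp
next
  case (Suc d)
  obtain c w where cw: "c \<in> snake_cells (Suc n)" "w \<in> fractal (Suc n)" "z = emb n c w"
    using fractal_cases[OF Suc.prems(1)] .
  obtain i j where c: "c = (i, j)" by (cases c)
  have w: "snd w \<le> 1/2" 
    using fractal_abs_le[OF cw(2)] abs_le_D1 by blast
  have eq: "real_of_int j + snd w = 2 * real n + 5 + 1/2"
    using Suc.prems(2) unfolding cw(3) c snd_emb emb_coord_eq by simp
  have "j \<le> 2 * int n + 5"
    using snake_cells_le cw(1) c by blast
  then have j: "j = 2 * int n + 5" using eq w by linarith
  then have w2: "snd w = 1/2" using eq by simp
  have "i = 0"
    using snake_cells_top_row[of i "Suc n"] cw(1) by (simp add: c j add.commute)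
  then have "\<bar>fst z\<bar> = \<bar>fst w\<bar> / (4 * real n + 11)"
    by (simp add: cw(3) c fst_emb)
  also have "\<dots> \<le> \<bar>fst w\<bar> / 2"
    by (rule divide_left_mono) auto
  also have "\<dots> \<le> (1/2) ^ d / 2" using Suc.IH[OF cw(2) w2] by simp
  finally show ?case by simp
qed

lemma fractal_top_side:
  assumes "z \<in> fractal n" "snd z = 1/2"
  shows "z = (0, 1/2)"
proof -
  have "\<bar>fst z\<bar> \<le> 0"
    using fractal_top_side_aux[OF assms]
    by (intro LIMSEQ_le_const[OF LIMSEQ_power_zero[of "1/2::real"]]) auto
  then show ?thesis using assms(2) by (cases z) simp
qed

lemma fractal_sides:
  assumes "z \<in> fractal n"
  shows "snd z = - 1/2 \<Longrightarrow> z = (0, - 1/2)" "fst z = 1/2 \<Longrightarrow> z = (1/2, 0)" "fst z = - 1/2 \<Longrightarrow> z = (- 1/2, 0)"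
proof -
  have r: "rot z \<in> fractal n" "rot (rot z) \<in> fractal n" "rot (rot (rot z)) \<in> fractal n"
    using assms rot_fractal by blast+
  show "snd z = - 1/2 \<Longrightarrow> z = (0, - 1/2)"
    using fractal_top_side[OF r(2)] by (cases z) (simp add: rot_def)
  show "fst z = 1/2 \<Longrightarrow> z = (1/2, 0)"
    using fractal_top_side[OF r(1)] by (cases z) (simp add: rot_def)
  show "fst z = - 1/2 \<Longrightarrow> z = (- 1/2, 0)"
    using fractal_top_side[OF r(3)] by (cases z) (simp add: rot_def)
qed

definition exits :: "(real \<times> real) set" where
  "exits = {(0, 1/2), (- 1/2, 0), (0, - 1/2), (1/2, 0)}"

text \<open>
  For adjacent cells \<open>u\<close> and \<open>v\<close>, the point \<open>half (v - u)\<close> is the exit of the copy in \<open>u\<close> towards \<open>v\<close>.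
\<close>

definition half :: "int \<times> int \<Rightarrow> real \<times> real" where
  "half c = (of_int (fst c) / 2, of_int (snd c) / 2)"

lemma adjacent_half_exits: "adjacent u v \<Longrightarrow> half (v - u) \<in> exits"
  using adjacent_cases[of "fst u" "snd u" v] by (cases u) (auto simp: half_def exits_def)

text \<open>
  Copies of the fractal in diagonal neighbours are disjoint, because a common point would be a corner,
  and no corner is a midpoint of a side.
\<close>

lemma fractal_cells_meet:
  assumes "emb n u w = emb n v w'" "u \<noteq> v" "w \<in> fractal (Suc n)" "w' \<in> fractal (Suc n)"
  shows "adjacent u v" "w = half (v - u)"
proof -
  obtain a b where u: "u = (a, b)" by (cases u)
  obtain c d where v: "v = (c, d)" by (cases v)
  have box: "\<bar>fst w\<bar> \<le> 1/2" "\<bar>snd w\<bar> \<le> 1/2" "\<bar>fst w'\<bar> \<le> 1/2" "\<bar>snd w'\<bar> \<le> 1/2"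
    using fractal_abs_le assms(3,4) by blast+
  have eq: "of_int a + fst w = of_int c + fst w'" "of_int b + snd w = of_int d + snd w'"
    using assms(1) by (auto simp: emb_def u v prod_eq_iff)
  have "\<bar>a - c\<bar> \<le> 1" "\<bar>b - d\<bar> \<le> 1" using eq box by linarith+
  then consider "a = c" "b = d" | "c = a + 1" | "c = a - 1" | "a = c" "d = b + 1" | "a = c" "d = b - 1"
    by linarith
  then have "adjacent u v \<and> w = half (v - u)"
  proof cases
    case 1
    then show ?thesis using assms(2) u v by simp
  next
    case 2
    then have "fst w = 1/2" "fst w' = - 1/2" using eq(1) box by auto
    then have w: "w = (1/2, 0)" "w' = (- 1/2, 0)" using fractal_sides assms(3,4) by blast+
    then have "b = d" using eq(2) by simp
    then show ?thesis using 2 w by (simp add: u v half_def adjacent_def)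
  next
    case 3
    then have "fst w = - 1/2" "fst w' = 1/2" using eq(1) box by auto
    then have w: "w = (- 1/2, 0)" "w' = (1/2, 0)" using fractal_sides assms(3,4) by blast+
    then have "b = d" using eq(2) by simp
    then show ?thesis using 3 w by (simp add: u v half_def adjacent_def)
  next
    case 4
    then have "snd w = 1/2" using eq(2) box by auto
    then have w: "w = (0, 1/2)" using fractal_top_side assms(3) by blast
    then show ?thesis using 4 w by (simp add: u v half_def adjacent_def)
  next
    case 5
    then have "snd w = - 1/2" using eq(2) box by auto
    then have w: "w = (0, - 1/2)" using fractal_sides assms(3) by blast
    then show ?thesis using 5 w by (simp add: u v half_def adjacent_def)
  qed
  then show "adjacent u v" "w = half (v - u)" by blast+
qed

definition pieces :: "nat \<Rightarrow> (int \<times> int) set \<Rightarrow> (real \<times> real) set" where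
  "pieces n H = (\<Union>c\<in>H. emb n c ` fractal (Suc n))"

text \<open>
  The part of \<open>C\<close> in the cell \<open>c\<close>, enlarged to the size of the unit square.
\<close>

definition zoom :: "nat \<Rightarrow> int \<times> int \<Rightarrow> (real \<times> real) set \<Rightarrow> (real \<times> real) set" where
  "zoom n c C = {w \<in> fractal (Suc n). emb n c w \<in> C}"

lemma fractal_subset_pieces: "fractal n \<subseteq> pieces n (snake_cells (Suc n))"
proof
  fix z assume "z \<in> fractal n"
  then show "z \<in> pieces n (snake_cells (Suc n))"
    by (rule fractal_cases) (auto simp: pieces_def)
qed

lemma closed_pieces: "finite H \<Longrightarrow> closed (pieces n H)"
  unfolding pieces_def using compact_fractal continuous_on_emb
  by (intro compact_imp_closed compact_UN) (auto intro: compact_continuous_image)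

lemma pieces_Un: "pieces n (G \<union> H) = pieces n G \<union> pieces n H"
  by (auto simp: pieces_def)

lemma pieces_mono: "G \<subseteq> H \<Longrightarrow> pieces n G \<subseteq> pieces n H"
  by (auto simp: pieces_def)

lemma zoom_subset: "zoom n c C \<subseteq> fractal (Suc n)"
  by (auto simp: zoom_def)

lemma zoom_eq: "zoom n c C = (\<lambda>z. (4 * real n + 11) *\<^sub>R z - (of_int (fst c), of_int (snd c))) ` (C \<inter> pieces n {c})"
  by (force simp: zoom_def pieces_def emb_def image_iff)

lemma connected_zoom: "connected (C \<inter> pieces n {c}) \<Longrightarrow> connected (zoom n c C)"
  unfolding zoom_eq by (rule connected_continuous_image) (intro continuous_intros)

lemma emb_image_zoom: "emb n c ` zoom n c C = C \<inter> pieces n {c}"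
  by (auto simp: zoom_def pieces_def)

text \<open>
  If the part in \<open>A\<close> were separated, the side without \<open>p\<close> would also be separated from \<open>B\<close>,
  hence from the rest of \<open>C\<close>.
\<close>

lemma connected_cut:
  fixes C :: "'a::t2_space set"
  assumes "connected C" "C \<subseteq> A \<union> B" "closed A" "closed B" "A \<inter> B \<subseteq> {p}"
    and "C \<inter> A \<noteq> {}" "C \<inter> B \<noteq> {}"
  shows "p \<in> C \<inter> A \<inter> B \<and> connected (C \<inter> A)"
proof -
  have "A \<inter> B \<inter> C \<noteq> {}"
    using connected_closedD[OF assms(1) _ assms(2,3,4)] assms(6,7) by blast
  then have p: "p \<in> C \<and> p \<in> A \<and> p \<in> B" using assms(5) by auto
  have no_separation: False if S: "closed S" and T: "closed T" and cov: "C \<inter> A \<subseteq> S \<union> T"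
    and disj: "S \<inter> T \<inter> (C \<inter> A) = {}" and ne: "T \<inter> (C \<inter> A) \<noteq> {}" and pS: "p \<in> S" for S T
  proof -
    have cl: "closed (S \<inter> A \<union> B)" "closed (T \<inter> A)" using S T assms(3,4) by auto
    have cov': "C \<subseteq> (S \<inter> A \<union> B) \<union> (T \<inter> A)" using cov assms(2) by blast
    have "p \<notin> T" using disj p pS by blast
    then have disj': "(S \<inter> A \<union> B) \<inter> (T \<inter> A) \<inter> C = {}" using disj assms(5) by blast
    have "(S \<inter> A \<union> B) \<inter> C \<noteq> {}" "(T \<inter> A) \<inter> C \<noteq> {}" using ne p by blast+
    then show False using connected_closedD[OF assms(1) disj' cov' cl] by blast
  qed
  have "connected (C \<inter> A)"
    unfolding connected_closed
  proof (rule notI, elim exE conjE)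
    fix S T assume S: "closed S" and T: "closed T" and cov: "C \<inter> A \<subseteq> S \<union> T"
      and disj: "S \<inter> T \<inter> (C \<inter> A) = {}" and ne: "S \<inter> (C \<inter> A) \<noteq> {}" "T \<inter> (C \<inter> A) \<noteq> {}"
    have "p \<in> S \<or> p \<in> T" using cov p by blast
    moreover have "C \<inter> A \<subseteq> T \<union> S" "T \<inter> S \<inter> (C \<inter> A) = {}" using cov disj by blast+
    ultimately show False using no_separation[OF S T cov disj ne(2)] no_separation[OF T S _ _ ne(1)] by blast
  qed
  then show ?thesis using p by blast
qed

section \<open>Separated points on a crossing\<close>

text \<open>
  Lower bounds on covering numbers come from large sets of points that are pairwise far apart: a set
  of smaller diameter contains at most one of them.
\<close>

definition separated :: "real \<Rightarrow> nat \<Rightarrow> 'a::metric_space set \<Rightarrow> bool" where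
  "separated \<delta> N C \<longleftrightarrow>
     (\<exists>X. X \<subseteq> C \<and> finite X \<and> card X = N \<and> (\<forall>p\<in>X. \<forall>q\<in>X. p \<noteq> q \<longrightarrow> \<delta> \<le> dist p q))"

lemma separated_mono: "separated \<delta> N C \<Longrightarrow> C \<subseteq> D \<Longrightarrow> separated \<delta> N D"
  unfolding separated_def by (elim exE, intro exI) blast

lemma separated_image:
  assumes "separated \<delta> N C" "r > 0" "\<And>p q. dist (f p) (f q) = r * dist p q"
  shows "separated (r * \<delta>) N (f ` C)"
proof -
  obtain X where X: "X \<subseteq> C" "finite X" "card X = N" "\<And>p q. p \<in> X \<Longrightarrow> q \<in> X \<Longrightarrow> p \<noteq> q \<Longrightarrow> \<delta> \<le> dist p q"
    using assms(1) unfolding separated_def by blast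
  have "inj f"
  proof (rule injI)
    fix p q assume "f p = f q"
    then have "r * dist p q = 0" using assms(3)[of p q] by simp
    then show "p = q" using assms(2) by simp
  qed
  then have "card (f ` X) = N" using X(3) card_image inj_on_subset by blast
  moreover have "r * \<delta> \<le> dist p' q'" if "p' \<in> f ` X" "q' \<in> f ` X" "p' \<noteq> q'" for p' q'
  proof -
    from that obtain p q where "p' = f p" "q' = f q" "p \<in> X" "q \<in> X" "p \<noteq> q" by blast
    then show ?thesis using X(4)[of p q] assms(2,3) by simp
  qed
  ultimately show ?thesis
    using X(1,2) unfolding separated_def by (intro exI[of _ "f ` X"]) blast
qed

text \<open>
  Restricting to cells with even coordinates leaves a gap of at least one cell between any two of them.
\<close>

lemma dist_emb_far_cells:
  assumes "w \<in> fractal (Suc n)" "w' \<in> fractal (Suc n)" "c \<noteq> c'"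
    and "even (fst c)" "even (snd c)" "even (fst c')" "even (snd c')"
  shows "1 / (4 * real n + 11) \<le> dist (emb n c w) (emb n c' w')"
proof -
  let ?m = "4 * real n + 11"
  have far: "\<bar>real_of_int (a - b) + (x - y)\<bar> \<ge> 1"
    if "even a" "even b" "a \<noteq> b" "\<bar>x\<bar> \<le> 1/2" "\<bar>y\<bar> \<le> 1/2" for a b :: int and x y :: real
  proof -
    have "\<bar>a - b\<bar> \<ge> 2" using that(1-3) by presburger
    then have "\<bar>real_of_int (a - b)\<bar> \<ge> 2" by linarith
    then show ?thesis using that(4,5) by linarith
  qed
  have eq: "fst (emb n c w) - fst (emb n c' w') = (real_of_int (fst c - fst c') + (fst w - fst w')) / ?m"
    "snd (emb n c w) - snd (emb n c' w') = (real_of_int (snd c - snd c') + (snd w - snd w')) / ?m"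
    by (simp_all add: fst_emb snd_emb algebra_simps flip: diff_divide_distrib)
  have "1 / ?m \<le> \<bar>fst (emb n c w) - fst (emb n c' w')\<bar> \<or> 1 / ?m \<le> \<bar>snd (emb n c w) - snd (emb n c' w')\<bar>"
    using far[of "fst c" "fst c'" "fst w" "fst w'"] far[of "snd c" "snd c'" "snd w" "snd w'"]
      assms fractal_abs_le unfolding eq abs_divide
    by (auto simp: prod_eq_iff intro!: divide_right_mono)
  then show ?thesis
    using dist_fst_le[of "emb n c w" "emb n c' w'"] dist_snd_le[of "emb n c w" "emb n c' w'"]
    by (auto simp: dist_real_def)
qed

lemma separated_UN_cells:
  assumes S: "finite S" "\<And>c. c \<in> S \<Longrightarrow> even (fst c) \<and> even (snd c)"
    and sep: "\<And>c. c \<in> S \<Longrightarrow> separated \<delta> N (zoom n c C)" and \<delta>: "0 < \<delta>" "\<delta> \<le> 1"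
  shows "separated (\<delta> / (4 * real n + 11)) (card S * N) C"
proof -
  let ?m = "4 * real n + 11"
  obtain X where X: "\<And>c. c \<in> S \<Longrightarrow> X c \<subseteq> zoom n c C \<and> finite (X c) \<and> card (X c) = N \<and>
      (\<forall>p\<in>X c. \<forall>q\<in>X c. p \<noteq> q \<longrightarrow> \<delta> \<le> dist p q)"
    using sep unfolding separated_def by metis
  let ?Y = "SIGMA c:S. X c"
  let ?f = "\<lambda>(c, w). emb n c w"
  have far: "\<delta> / ?m \<le> dist (?f p) (?f q)" if pq: "p \<in> ?Y" "q \<in> ?Y" "p \<noteq> q" for p q
  proof -
    obtain c w c' w' where p: "p = (c, w)" and q: "q = (c', w')" by (cases p, cases q)
    have c: "c \<in> S" "w \<in> X c" "c' \<in> S" "w' \<in> X c'" using pq p q by auto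
    show ?thesis
    proof (cases "c = c'")
      case True
      then have "w \<noteq> w'" using pq p q by simp
      then have "\<delta> \<le> dist w w'" using X c True by blast
      then show ?thesis using True by (simp add: p q dist_emb divide_right_mono)
    next
      case False
      have "w \<in> fractal (Suc n)" "w' \<in> fractal (Suc n)"
        using X c zoom_subset by blast+
      then have "1 / ?m \<le> dist (emb n c w) (emb n c' w')"
        using dist_emb_far_cells False S(2) c by blast
      moreover have "\<delta> / ?m \<le> 1 / ?m" using \<delta> by (simp add: divide_right_mono)
      ultimately show ?thesis by (simp add: p q)
    qed
  qed
  have "inj_on ?f ?Y"
  proof (rule inj_onI, rule ccontr)
    fix p q assume "p \<in> ?Y" "q \<in> ?Y" "?f p = ?f q" "p \<noteq> q"
    moreover have "\<delta> / ?m > 0" using \<delta> by simp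
    ultimately show False using far[of p q] by simp
  qed
  then have "card (?f ` ?Y) = card ?Y" by (rule card_image)
  also have "\<dots> = card S * N" using S X by (simp add: card_SigmaI)
  finally have "card (?f ` ?Y) = card S * N" .
  moreover have "finite (?f ` ?Y)" using S X by (auto intro!: finite_SigmaI)
  moreover have "?f ` ?Y \<subseteq> C"
  proof
    fix z assume "z \<in> ?f ` ?Y"
    then obtain c w where "c \<in> S" "w \<in> X c" "z = emb n c w" by auto
    moreover from this have "w \<in> zoom n c C" using X by blast
    ultimately show "z \<in> C" by (simp add: zoom_def)
  qed
  ultimately show ?thesis
    unfolding separated_def by (intro exI[of _ "?f ` ?Y"]) (use far in blast)
qed

definition unrot :: "real \<times> real \<Rightarrow> real \<times> real" where
  "unrot p = (snd p, - fst p)"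

lemma unrot_rot [simp]: "unrot (rot p) = p" "rot (unrot p) = p"
  by (simp_all add: rot_def unrot_def)

lemma dist_unrot: "dist (unrot p) (unrot q) = dist p q"
  by (simp add: unrot_def dist_Pair_Pair dist_minus add.commute dist_prod_def)

lemma separated_rot:
  assumes "separated \<delta> N (rot ` C)"
  shows "separated \<delta> N C"
  using separated_image[OF assms, of 1 unrot] dist_unrot by (simp add: image_image)

lemma connected_rot: "connected C \<Longrightarrow> connected (rot ` C)"
  unfolding rot_def by (rule connected_continuous_image) (intro continuous_intros)

lemma rot_exits: "rot e \<in> exits \<longleftrightarrow> e \<in> exits"
  by (cases e) (auto simp: rot_def exits_def)

definition crossing :: "nat \<Rightarrow> (real \<times> real) set \<Rightarrow> bool" where
  "crossing n C \<longleftrightarrow>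
     connected C \<and> C \<subseteq> fractal n \<and> (\<exists>e f. e \<in> exits \<inter> C \<and> f \<in> exits \<inter> C \<and> e \<noteq> f)"

lemma crossing_rot:
  assumes "crossing n C"
  shows "crossing n (rot ` C)"
proof -
  obtain e f where "e \<in> exits \<inter> C" "f \<in> exits \<inter> C" "e \<noteq> f" 
    using assms unfolding crossing_def by blast
  moreover have "rot e \<noteq> rot f" using \<open>e \<noteq> f\<close> unrot_rot(1) by metis
  ultimately show ?thesis
    using assms connected_rot rot_fractal unfolding crossing_def
    by (intro conjI exI[of _ "rot e"] exI[of _ "rot f"]) (auto simp: rot_exits)
qed

text \<open>
  Rotating until a given exit is on top allows to argue in the top arm only.
\<close>

lemma exits_rotate_to_top:
  assumes "e \<in> exits \<inter> C"
    and "\<And>C. (0, 1/2) \<in> C \<Longrightarrow> P C \<Longrightarrow> Q C"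
    and "\<And>C. P C \<Longrightarrow> P (rot ` C)" "\<And>C. Q (rot ` C) \<Longrightarrow> Q C" and "P C"
  shows "Q C"
proof -
  have right: "Q C" if "(1/2, 0) \<in> C" "P C" for C
  proof -
    have "(0, 1/2) \<in> rot ` C" using that(1) by (force simp: rot_def)
    then show ?thesis using assms(2-4) that(2) by blast
  qed
  have bottom: "Q C" if "(0, - 1/2) \<in> C" "P C" for C
  proof -
    have "(1/2, 0) \<in> rot ` C" using that(1) by (force simp: rot_def)
    then show ?thesis using right assms(3,4) that(2) by blast
  qed
  have left: "Q C" if "(- 1/2, 0) \<in> C" "P C" for C
  proof -
    have "(0, - 1/2) \<in> rot ` C" using that(1) by (force simp: rot_def)
    then show ?thesis using bottom assms(3,4) that(2) by blast
  qed
  show ?thesis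
    using assms(1,2,5) right bottom left unfolding exits_def by blast
qed

lemma top_exit_cell:
  assumes "emb n c w = (0, 1/2)" "c \<in> snake_cells (Suc n)" "w \<in> fractal (Suc n)"
  shows "c = (0, 2 * int n + 5)" "w = (0, 1/2)"
proof -
  obtain i j where c: "c = (i, j)" by (cases c)
  have eq: "of_int i + fst w = 0" "real_of_int j + snd w = 2 * real n + 5 + 1/2"
    using assms(1) unfolding prod_eq_iff fst_emb snd_emb emb_coord_eq by (simp_all add: c)
  have "j \<le> 2 * int n + 5"
    using snake_cells_le assms(2) c by blast
  moreover have "snd w \<le> 1/2" using fractal_abs_le[OF assms(3)] abs_le_D1 by blast
  ultimately have j: "j = 2 * int n + 5" using eq(2) by linarith
  then have "snd w = 1/2" using eq by simp
  then show w: "w = (0, 1/2)" using fractal_top_side assms(3) by blast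
  show "c = (0, 2 * int n + 5)" using eq(1) w by (simp add: c j)
qed

text \<open>
  The other three exits belong to cells outside the sector of the top arm.
\<close>

lemma other_exit_cell:
  assumes "emb n (x, y) w \<in> exits" "emb n (x, y) w \<noteq> (0, 1/2)"
    "(x, y) \<in> snake_cells (Suc n)" "w \<in> fractal (Suc n)"
  shows "\<not> \<bar>x\<bar> < y"
proof
  assume xy: "\<bar>x\<bar> < y"
  have y: "y \<le> 2 * int n + 5" using snake_cells_le assms(3) by blast
  have w: "\<bar>fst w\<bar> \<le> 1/2" "\<bar>snd w\<bar> \<le> 1/2" using fractal_abs_le[OF assms(4)] by auto
  have real: "\<bar>real_of_int x\<bar> \<le> 2 * real n + 4" "real_of_int y \<ge> 1" using xy y by linarith+
  have "fst (emb n (x, y) w) = - 1/2 \<or> snd (emb n (x, y) w) = - 1/2 \<or> fst (emb n (x, y) w) = 1/2"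
    using assms(1,2) unfolding exits_def by auto
  then have "of_int x + fst w = - (2 * real n + 11/2) \<or> of_int y + snd w = - (2 * real n + 11/2) \<or>
      of_int x + fst w = 2 * real n + 11/2"
    unfolding fst_emb snd_emb emb_coord_eq by (simp add: algebra_simps)
  then show False using real w by linarith
qed

text \<open>
  The two thresholds are the two vertical sides of the cell \<open>(2 * i, 2 * l + 4)\<close>, which lies in the
  interior of its row.
\<close>

lemma pieces_outer_rest:
  assumes "1 \<le> n" "l < n" "\<bar>i\<bar> \<le> int l" "t = turn (l + 2) * (2 * i) \<or> t = turn (l + 2) * (2 * i) + 1"
    and "u \<in> outer (Suc n) (l + 2) t" "v \<in> snake_cells (Suc n)" "v \<notin> outer (Suc n) (l + 2) t"
    and "emb n u w = emb n v w'" "w \<in> fractal (Suc n)" "w' \<in> fractal (Suc n)"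
  shows "u = (turn (l + 2) * t, 2 * int l + 4)" "v = (turn (l + 2) * (t - 1), 2 * int l + 4)"
    "w = half (- turn (l + 2), 0)"
proof -
  let ?s = "turn (l + 2)"
  have s: "?s = 1 \<or> ?s = - 1" by (rule turn_cases)
  have "\<bar>?s * (2 * i)\<bar> \<le> 2 * int l" using s assms(3) by auto
  then have t: "- (2 * int (l + 2) - 3) < t" "t \<le> 2 * int (l + 2) - 1"
    using assms(4) by auto
  have "u \<noteq> v" using assms by blast
  then have adj: "adjacent u v" "w = half (v - u)" using fractal_cells_meet assms(8-10) by blast+
  have uv: "u = (?s * t, 2 * int (l + 2)) \<and> v = (?s * (t - 1), 2 * int (l + 2))"
    by (rule outer_adjacent[OF _ _ _ t assms(5-7) adj(1)]) (use assms in auto)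
  then show "u = (?s * t, 2 * int l + 4)" "v = (?s * (t - 1), 2 * int l + 4)" by auto
  show "w = half (- ?s, 0)" using adj(2) uv by (simp add: algebra_simps)
qed

text \<open>
  Both vertical sides of the cell separate the top exit from the other exits.  Cutting at the first
  one leaves a connected set in the outer part of the arm; cutting this at the second one leaves
  exactly the part in the cell, which contains both cut points.  That the cell is white is a
  by-product of the first cut.
\<close>

lemma crossing_straight_cell:
  assumes C: "connected C" "C \<subseteq> fractal n" and top: "(0, 1/2) \<in> C"
    and f: "f \<in> exits" "f \<in> C" "f \<noteq> (0, 1/2)" and l: "l < n" and i: "\<bar>i\<bar> \<le> int l"
  shows "crossing (Suc n) (zoom n (2 * i, 2 * int l + 4) C)"
proof -
  define s where "s = turn (l + 2)"
  define O1 where "O1 = outer (Suc n) (l + 2) (s * (2 * i))"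
  define O2 where "O2 = outer (Suc n) (l + 2) (s * (2 * i) + 1)"
  define c where "c = (2 * i, 2 * int l + 4)"
  let ?cells = "snake_cells (Suc n)"
  have n: "1 \<le> n" using l by simp
  have s: "s = 1 \<or> s = - 1" unfolding s_def by (rule turn_cases)
  have fin: "finite ?cells" using finite_snake_cells by simp
  have sub: "O1 \<subseteq> ?cells" "O2 \<subseteq> ?cells" by (auto simp: O1_def O2_def outer_def)
  then have finO: "finite O1" "finite O2" using fin finite_subset by blast+
  have cover: "C \<subseteq> pieces n ?cells" using C(2) fractal_subset_pieces by blast
  have meet1: "u = c \<and> w = half (- s, 0)"
    if "u \<in> O1" "v \<in> ?cells - O1" "emb n u w = emb n v w'" "w \<in> fractal (Suc n)" "w' \<in> fractal (Suc n)" for u v w w'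
    using pieces_outer_rest[OF n l i, of "s * (2 * i)" u v w w'] that s
    by (auto simp: O1_def s_def c_def)
  have meet2: "v = c \<and> w' = half (s, 0)"
    if "u \<in> O2" "v \<in> ?cells - O2" "emb n u w = emb n v w'" "w \<in> fractal (Suc n)" "w' \<in> fractal (Suc n)" for u v w w'
  proof -
    have uv: "u = (s * (s * (2 * i) + 1), 2 * int l + 4)" "v = (s * (s * (2 * i) + 1 - 1), 2 * int l + 4)"
      using pieces_outer_rest(1,2)[OF n l i, of "s * (2 * i) + 1" u v w w'] that
      by (auto simp: O2_def s_def)
    then have u: "u = (2 * i + s, 2 * int l + 4)" and v: "v = c"
      using s by (auto simp: c_def algebra_simps)
    have "v \<noteq> u" using u v s by (auto simp: c_def)
    then have "w' = half (u - v)" using fractal_cells_meet(2)[of n v w' u w] that by simp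
    then show ?thesis using u v by (simp add: c_def)
  qed
  have top_in: "(0, 1/2) \<in> pieces n O1" "(0, 1/2) \<in> pieces n O2"
  proof -
    obtain d w where d: "d \<in> ?cells" "w \<in> fractal (Suc n)" "(0, 1/2) = emb n d w"
      using fractal_cases top C(2) by blast
    have "d = (0, 2 * int n + 5)" using top_exit_cell[of n d w] d by simp
    then have "d \<in> O1" "d \<in> O2" using d(1) l by (auto simp: O1_def O2_def outer_def)
    then show "(0, 1/2) \<in> pieces n O1" "(0, 1/2) \<in> pieces n O2" using d unfolding pieces_def by blast+
  qed
  have f_in: "f \<in> pieces n (?cells - O1)"
  proof -
    obtain d w where d: "d \<in> ?cells" "w \<in> fractal (Suc n)" "f = emb n d w"
      using fractal_cases f(2) C(2) by blast
    obtain x y where xy: "d = (x, y)" by (cases d)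
    have "\<not> \<bar>x\<bar> < y" using other_exit_cell[of n x y w] d f xy by simp
    then have "d \<notin> O1" using xy by (auto simp: O1_def outer_def)
    then show ?thesis using d unfolding pieces_def by blast
  qed
  define p1 where "p1 = emb n c (half (- s, 0))"
  define p2 where "p2 = emb n c (half (s, 0))"
  have cut1: "p1 \<in> C \<inter> pieces n O1 \<inter> pieces n (?cells - O1) \<and> connected (C \<inter> pieces n O1)"
  proof (rule connected_cut[OF C(1), of "pieces n O1" "pieces n (?cells - O1)" p1])
    show "C \<subseteq> pieces n O1 \<union> pieces n (?cells - O1)"
      using cover sub by (simp add: Un_absorb1 flip: pieces_Un)
    show "closed (pieces n O1)" "closed (pieces n (?cells - O1))"
      using closed_pieces finO fin by auto
    show "pieces n O1 \<inter> pieces n (?cells - O1) \<subseteq> {p1}"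
      using meet1 unfolding pieces_def p1_def by blast
    show "C \<inter> pieces n O1 \<noteq> {}" "C \<inter> pieces n (?cells - O1) \<noteq> {}"
      using top top_in f f_in by blast+
  qed
  obtain u v w w' where uv: "u \<in> O1" "v \<in> ?cells - O1" "p1 = emb n u w" "p1 = emb n v w'"
    "w \<in> fractal (Suc n)" "w' \<in> fractal (Suc n)"
    using cut1 unfolding pieces_def by blast
  have u: "u = c" "w = half (- s, 0)" using meet1[OF uv(1,2) _ uv(5,6)] uv(3,4) by auto
  then have c_O1: "c \<in> O1" using uv by simp
  have p1_c: "p1 \<in> pieces n {c}" using uv u by (auto simp: pieces_def)
  \<comment> \<open>The cell itself is all that remains of the outer part between the two cuts.\<close>
  have c_O2: "c \<notin> O2" using s by (auto simp: c_def O2_def outer_def s_def)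
  have O1_sub: "O1 \<subseteq> {c} \<union> O2"
    using s by (auto simp: O1_def O2_def outer_def c_def s_def)
  have cut2: "p2 \<in> C \<inter> pieces n O1 \<inter> pieces n {c} \<inter> pieces n O2 \<and>
    connected (C \<inter> pieces n O1 \<inter> pieces n {c})"
  proof (rule connected_cut[OF conjunct2[OF cut1], of "pieces n {c}" "pieces n O2" p2])
    show "C \<inter> pieces n O1 \<subseteq> pieces n {c} \<union> pieces n O2"
      using pieces_mono[OF O1_sub, of n] unfolding pieces_Un by blast
    show "closed (pieces n {c})" "closed (pieces n O2)"
      using closed_pieces finO by auto
    show "pieces n {c} \<inter> pieces n O2 \<subseteq> {p2}"
    proof
      fix z assume "z \<in> pieces n {c} \<inter> pieces n O2"
      then obtain u w w' where z: "u \<in> O2" "z = emb n u w" "z = emb n c w'"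
        "w \<in> fractal (Suc n)" "w' \<in> fractal (Suc n)"
        unfolding pieces_def by blast
      then have "w' = half (s, 0)" using meet2[of u c w w'] c_O1 c_O2 sub by auto
      then show "z \<in> {p2}" using z by (simp add: p2_def)
    qed
    show "C \<inter> pieces n O1 \<inter> pieces n {c} \<noteq> {}" "C \<inter> pieces n O1 \<inter> pieces n O2 \<noteq> {}"
      using cut1 p1_c top top_in by blast+
  qed
  have "pieces n {c} \<subseteq> pieces n O1" using c_O1 by (intro pieces_mono) simp
  then have "C \<inter> pieces n O1 \<inter> pieces n {c} = C \<inter> pieces n {c}" by blast
  then have "connected (zoom n c C)" using cut2 connected_zoom by simp
  moreover have "half (- s, 0) \<in> zoom n c C"
    using uv(5) u cut1 by (simp add: zoom_def p1_def)
  moreover have "half (s, 0) \<in> zoom n c C"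
  proof -
    obtain w where "w \<in> fractal (Suc n)" "p2 = emb n c w"
      using cut2 unfolding pieces_def by blast
    then show ?thesis using cut2 by (auto simp: zoom_def p2_def emb_inj)
  qed
  moreover have "half (- s, 0) \<in> exits" "half (s, 0) \<in> exits" "half (s, 0) \<noteq> half (- s, 0)"
    using s by (auto simp: half_def exits_def)
  ultimately have "crossing (Suc n) (zoom n c C)"
    unfolding crossing_def
    by (intro conjI zoom_subset exI[of _ "half (- s, 0)"] exI[of _ "half (s, 0)"] IntI) auto
  then show ?thesis by (simp only: c_def)
qed

text \<open>
  Row \<open>2 * l + 4\<close> of the arm contains all abscissas from \<open>- (2 * l + 1)\<close> to \<open>2 * l + 1\<close>, whichever
  its direction, for \<open>l < n\<close> in the pattern with index \<open>n + 1\<close>.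
\<close>

definition straight_cells :: "nat \<Rightarrow> (int \<times> int) set" where
  "straight_cells n = (\<lambda>(l, i). (2 * i, 2 * int l + 4)) ` (SIGMA l:{..<n}. {- int l..int l})"

lemma card_straight_cells: "card (straight_cells n) = n\<^sup>2"
proof -
  have "card (straight_cells n) = card (SIGMA l:{..<n}. {- int l..int l})"
    unfolding straight_cells_def by (intro card_image inj_onI) (simp add: case_prod_unfold prod_eq_iff)
  also have "\<dots> = (\<Sum>l<n. 2 * l + 1)" by (simp add: nat_add_distrib nat_mult_distrib)
  also have "\<dots> = n\<^sup>2" by (induction n) (auto simp: power2_eq_square)
  finally show ?thesis .
qed

text \<open>
  The side length of the white squares \<open>d\<close> levels below a unit square in which \<open>n\<close> patterns have
  already been used.
\<close>

definition mesh :: "nat \<Rightarrow> nat \<Rightarrow> real" where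
  "mesh n d = (\<Prod>i<d. 1 / (4 * real (n + i) + 11))"

lemma mesh_Suc: "mesh n (Suc d) = mesh (Suc n) d / (4 * real n + 11)"
  unfolding mesh_def prod.lessThan_Suc_shift by (simp add: algebra_simps)

lemma mesh_pos: "mesh n d > 0"
  unfolding mesh_def by (intro prod_pos) auto

lemma mesh_le_1: "mesh n d \<le> 1"
  unfolding mesh_def by (intro prod_le_1) auto

text \<open>
  A crossing passes through \<open>n\<^sup>2\<close> cells with even coordinates, each of which is crossed again; points
  in different cells are further apart than needed, and points in the same cell are handled by
  induction on the depth.
\<close>

lemma crossing_separated:
  assumes "crossing n C"
  shows "separated (mesh n d) (\<Prod>i<d. (n + i)\<^sup>2) C"
  using assms
proof (induction d arbitrary: n C)
  case 0
  then obtain e where "e \<in> C" unfolding crossing_def by blast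
  then show ?case unfolding separated_def by (intro exI[of _ "{e}"]) auto
next
  case (Suc d)
  let ?N = "\<lambda>n d. \<Prod>i<d. (n + i)\<^sup>2"
  have top: "separated (mesh n (Suc d)) (?N n (Suc d)) C"
    if top_in: "(0, 1/2) \<in> C" and cr: "crossing n C" for C
  proof -
    obtain f where f: "f \<in> exits" "f \<in> C" "f \<noteq> (0, 1/2)"
      using cr unfolding crossing_def by blast
    have C: "connected C" "C \<subseteq> fractal n" using cr unfolding crossing_def by blast+
    have "separated (mesh (Suc n) d / (4 * real n + 11)) (card (straight_cells n) * ?N (Suc n) d) C"
    proof (rule separated_UN_cells)
      fix c assume "c \<in> straight_cells n"
      then obtain l i where c: "c = (2 * i, 2 * int l + 4)" "l < n" "\<bar>i\<bar> \<le> int l"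
        by (auto simp: straight_cells_def)
      then show "even (fst c) \<and> even (snd c)" by simp
      have "crossing (Suc n) (zoom n c C)"
        using crossing_straight_cell[OF C top_in f c(2,3)] unfolding c(1) .
      then show "separated (mesh (Suc n) d) (?N (Suc n) d) (zoom n c C)" by (rule Suc.IH)
    qed (auto simp: straight_cells_def mesh_pos mesh_le_1)
    moreover have "?N n (Suc d) = n\<^sup>2 * ?N (Suc n) d"
      unfolding prod.lessThan_Suc_shift by simp
    ultimately show ?thesis by (simp add: mesh_Suc card_straight_cells)
  qed
  obtain e where "e \<in> exits \<inter> C" using Suc.prems unfolding crossing_def by blast
  then show ?case
    by (rule exits_rotate_to_top[where P = "crossing n"]) (use top crossing_rot separated_rot Suc.prems in blast)+
qed

section \<open>Every connected set with two points contains a crossing\<close>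

text \<open>
  What a crossing of some white square \<open>j\<close> levels below implies, in terms of points only.  The condition
  \<open>n + j \<ge> 1\<close> ensures that no factor of the product vanishes.
\<close>

definition plump :: "nat \<Rightarrow> (real \<times> real) set \<Rightarrow> bool" where
  "plump n C \<longleftrightarrow>
     (\<exists>j. n + j \<ge> 1 \<and> (\<forall>d. separated (mesh n (j + d)) (\<Prod>i<d. (n + j + i)\<^sup>2) C))"

lemma plump_rot: "plump n (rot ` C) \<Longrightarrow> plump n C"
  unfolding plump_def using separated_rot by blast

lemma plump_zoom:
  assumes "plump (Suc n) (zoom n c C)"
  shows "plump n C"
proof -
  obtain j where j: "\<And>d. separated (mesh (Suc n) (j + d)) (\<Prod>i<d. (Suc n + j + i)\<^sup>2) (zoom n c C)"
    using assms unfolding plump_def by blast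
  have "separated (mesh n (Suc j + d)) (\<Prod>i<d. (n + Suc j + i)\<^sup>2) C" for d
  proof -
    have "separated (1 / (4 * real n + 11) * mesh (Suc n) (j + d)) (\<Prod>i<d. (Suc n + j + i)\<^sup>2)
        (emb n c ` zoom n c C)"
      by (rule separated_image[OF j]) (simp_all add: dist_emb)
    then have "separated (mesh n (Suc j + d)) (\<Prod>i<d. (n + Suc j + i)\<^sup>2) (emb n c ` zoom n c C)"
      by (simp add: mesh_Suc)
    then show ?thesis by (rule separated_mono) (auto simp: zoom_def)
  qed
  then show ?thesis unfolding plump_def by (intro exI[of _ "Suc j"]) simp
qed

lemma crossing_plump:
  assumes "crossing n C" "n \<ge> 1"
  shows "plump n C"
  unfolding plump_def using crossing_separated[OF assms(1)] assms(2) by (intro exI[of _ 0]) simp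

lemma fractal_dist_le:
  assumes "p \<in> fractal n" "q \<in> fractal n"
  shows "dist p q \<le> 2"
proof -
  have "dist (fst p) (fst q) \<le> 1" "dist (snd p) (snd q) \<le> 1"
    using fractal_abs_le[OF assms(1)] fractal_abs_le[OF assms(2)] by (auto simp: dist_real_def abs_le_iff)
  moreover have "dist p q \<le> dist (fst p) (fst q) + dist (snd p) (snd q)"
    unfolding dist_prod_def by (rule sqrt_sum_squares_le_sum) auto
  ultimately show ?thesis by linarith
qed

lemma zoom_dist:
  assumes "C \<subseteq> pieces n {c}" "p \<in> C" "q \<in> C" "2 / 2 ^ Suc t < dist p q"
  obtains v w where "p = emb n c v" "q = emb n c w" "v \<in> zoom n c C" "w \<in> zoom n c C" "2 / 2 ^ t < dist v w"
proof -
  obtain v where v: "p = emb n c v" "v \<in> zoom n c C" using assms(1,2) by (auto simp: pieces_def zoom_def)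
  obtain w where w: "q = emb n c w" "w \<in> zoom n c C" using assms(1,3) by (auto simp: pieces_def zoom_def)
  have "2 / 2 ^ Suc t < dist v w / (4 * real n + 11)" using assms(4) by (simp add: v w dist_emb)
  also have "\<dots> \<le> dist v w / 2" by (rule divide_left_mono) auto
  finally show thesis using that v w by simp
qed

lemma connected_zoom_whole:
  assumes "connected C" "C \<subseteq> pieces n {c}"
  shows "connected (zoom n c C)"
  using assms by (intro connected_zoom) (simp add: Int_absorb2)

text \<open>
  As long as \<open>C\<close> lies in the cell of the top exit, zoom into that cell; the bound on the distance
  shows that \<open>t\<close> zooms suffice to leave it.  Once \<open>C\<close> reaches another cell, it passes the bottom exit of
  the cell of the top exit, as this cell has only one neighbour, and therefore crosses this cell.
\<close>

lemma top_exit_plump: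
  assumes "connected C" "C \<subseteq> fractal n" "(0, 1/2) \<in> C" "q \<in> C" "2 / 2 ^ t < dist (0, 1/2) q"
  shows "plump n C"
  using assms
proof (induction t arbitrary: n C q)
  case 0
  then have "dist (0, 1/2) q \<le> 2" using fractal_dist_le by blast
  then show ?case using 0 by simp
next
  case (Suc t)
  let ?cells = "snake_cells (Suc n)"
  define c :: "int \<times> int" where "c = (0, 2 * int n + 5)"
  have c: "c \<in> ?cells" and w: "(0, 1/2) \<in> fractal (Suc n)" "emb n c (0, 1/2) = (0, 1/2)"
  proof -
    obtain d w where d: "d \<in> ?cells" "w \<in> fractal (Suc n)" "(0, 1/2) = emb n d w"
      using fractal_cases Suc.prems(2,3) by blast
    then have "d = c" "w = (0, 1/2)" using top_exit_cell[of n d w] by (simp_all add: c_def)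
    then show "c \<in> ?cells" "(0, 1/2) \<in> fractal (Suc n)" "emb n c (0, 1/2) = (0, 1/2)"
      using d by simp_all
  qed
  have w_zoom: "(0, 1/2) \<in> zoom n c C" using w Suc.prems(3) by (simp add: zoom_def)
  show ?case
  proof (cases "C \<subseteq> pieces n {c}")
    case True
    obtain v u where v: "(0, 1/2) = emb n c v" "u \<in> zoom n c C" "2 / 2 ^ t < dist v u"
      using zoom_dist[OF True Suc.prems(3-5)] by blast
    have "v = (0, 1/2)" using v(1) w(2) emb_inj by metis
    then have "plump (Suc n) (zoom n c C)"
      using Suc.IH[OF connected_zoom_whole[OF Suc.prems(1) True] zoom_subset w_zoom v(2)] v(3) by simp
    then show ?thesis by (rule plump_zoom)
  next
    case False
    define p where "p = emb n c (0, - 1/2)"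
    have fin: "finite ?cells" using finite_snake_cells by simp
    have cover: "C \<subseteq> pieces n {c} \<union> pieces n (?cells - {c})"
      using Suc.prems(2) fractal_subset_pieces[of n] c by (simp add: insert_absorb flip: pieces_Un)
    have "p \<in> C \<inter> pieces n {c} \<inter> pieces n (?cells - {c}) \<and> connected (C \<inter> pieces n {c})"
    proof (rule connected_cut[OF Suc.prems(1) cover])
      show "closed (pieces n {c})" "closed (pieces n (?cells - {c}))"
        using closed_pieces fin by auto
      show "pieces n {c} \<inter> pieces n (?cells - {c}) \<subseteq> {p}"
      proof
        fix z assume "z \<in> pieces n {c} \<inter> pieces n (?cells - {c})"
        then obtain v u u' where v: "v \<in> ?cells" "v \<noteq> c" "z = emb n c u" "z = emb n v u'"
          "u \<in> fractal (Suc n)" "u' \<in> fractal (Suc n)"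
          unfolding pieces_def by blast
        then have adj: "adjacent c v" "u = half (v - c)" using fractal_cells_meet[of n c u v u'] by auto
        have no: "(1, 2 * int n + 5) \<notin> ?cells" "(- 1, 2 * int n + 5) \<notin> ?cells" "(0, 2 * int n + 6) \<notin> ?cells"
          using snake_cells_top_row[of 1 "Suc n"] snake_cells_top_row[of "- 1" "Suc n"]
            snake_cells_le[of 0 "2 * int n + 6" n] by (auto simp: add.commute)
        have "v = (0, 2 * int n + 4)"
          using adjacent_cases[OF adj(1)[unfolded c_def]] v(1) no by (auto simp: add.commute)
        then have "u = (0, - 1/2)" using adj(2) by (simp add: half_def c_def)
        then show "z \<in> {p}" using v(3) by (simp add: p_def)
      qed
      show "C \<inter> pieces n {c} \<noteq> {}" using w_zoom emb_image_zoom[of n c C] by blast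
      show "C \<inter> pieces n (?cells - {c}) \<noteq> {}" using cover False by blast
    qed
    then have "connected (zoom n c C)" and p: "p \<in> C" "p \<in> pieces n {c}"
      using connected_zoom by blast+
    have "(0, - 1/2) \<in> zoom n c C"
      using p by (auto simp: p_def pieces_def zoom_def emb_inj)
    then have "crossing (Suc n) (zoom n c C)"
      unfolding crossing_def using \<open>connected (zoom n c C)\<close> w_zoom
      by (intro conjI zoom_subset exI[of _ "(0, 1/2)"] exI[of _ "(0, - 1/2)"]) (auto simp: exits_def)
    then show ?thesis using crossing_plump[of "Suc n"] plump_zoom[of n c C] by simp
  qed
qed

lemma obtain_power_less:
  assumes "(0::real) < r"
  obtains t where "2 / 2 ^ t < r"
proof -
  obtain t where "(1/2) ^ t < r / 2" using real_arch_pow_inv[of "r / 2" "1/2"] assms by auto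
  then show thesis using that[of t] by (simp add: power_one_over field_simps)
qed

lemma exit_plump:
  assumes "connected C" "C \<subseteq> fractal n" "e \<in> exits \<inter> C" "q \<in> C" "q \<noteq> e"
  shows "plump n C"
proof (rule exits_rotate_to_top[OF assms(3), where P = "\<lambda>C. connected C \<and> C \<subseteq> fractal n \<and> (\<exists>p\<in>C. \<exists>q\<in>C. p \<noteq> q)"])
  fix C assume top: "(0, 1/2) \<in> C" and C: "connected C \<and> C \<subseteq> fractal n \<and> (\<exists>p\<in>C. \<exists>q\<in>C. p \<noteq> q)"
  then obtain q where q: "q \<in> C" "q \<noteq> (0, 1/2)" by metis
  then obtain t where "2 / 2 ^ t < dist (0, 1/2) q"
    using obtain_power_less[of "dist (0, 1/2) q"] by auto
  then show "plump n C" using top_exit_plump C top q(1) by blast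
next
  fix C assume C: "connected C \<and> C \<subseteq> fractal n \<and> (\<exists>p\<in>C. \<exists>q\<in>C. p \<noteq> q)"
  then obtain p q where "p \<in> C" "q \<in> C" "rot p \<noteq> rot q" using unrot_rot(1) by metis
  then show "connected (rot ` C) \<and> rot ` C \<subseteq> fractal n \<and> (\<exists>p\<in>rot ` C. \<exists>q\<in>rot ` C. p \<noteq> q)"
    using C connected_rot rot_fractal by blast
qed (use assms plump_rot in blast)+

text \<open>
  If no cell of the cover can be omitted, then \<open>C\<close> has a point in each cell of the cover that lies in
  no other cell of it; this point differs from the exit through which \<open>C\<close> enters the cell.
\<close>

definition irredundant_cover :: "nat \<Rightarrow> (int \<times> int) set \<Rightarrow> (real \<times> real) set \<Rightarrow> bool" where
  "irredundant_cover n H C \<longleftrightarrow>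
     H \<subseteq> snake_cells (Suc n) \<and> C \<subseteq> pieces n H \<and> (\<forall>c\<in>H. \<not> C \<subseteq> pieces n (H - {c}))"

lemma irredundant_cover_exists:
  assumes "C \<subseteq> fractal n"
  obtains H where "irredundant_cover n H C"
proof -
  let ?P = "\<lambda>H. H \<subseteq> snake_cells (Suc n) \<and> C \<subseteq> pieces n H"
  have "?P (snake_cells (Suc n))" using assms fractal_subset_pieces by blast
  then obtain H where H: "?P H" "\<And>G. ?P G \<Longrightarrow> card H \<le> card G"
    using ex_has_least_nat[of ?P _ card] by metis
  have "finite H" using H(1) finite_snake_cells[of "Suc n"] finite_subset by auto
  have "\<not> C \<subseteq> pieces n (H - {c})" if "c \<in> H" for c
  proof
    assume "C \<subseteq> pieces n (H - {c})"
    then have "card H \<le> card (H - {c})" using H by blast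
    then show False using card_Diff1_less[OF \<open>finite H\<close> that] by linarith
  qed
  then show thesis using that H(1) unfolding irredundant_cover_def by blast
qed

text \<open>
  A finite part of a tree has a leaf: here the last cell of the cover in the order in which the arm
  is traversed, since such a cell can only have its predecessor as a neighbour in the cover.
\<close>

lemma extreme_cell_one_neighbour:
  assumes "H \<subseteq> snake_cells (Suc n)" "(x, y) \<in> H" "\<bar>x\<bar> < y"
    and max: "\<And>x' y'. (x', y') \<in> H \<Longrightarrow> \<bar>x'\<bar> < y' \<Longrightarrow>
      y' < y \<or> y' = y \<and> turn (nat (y div 2)) * x' \<le> turn (nat (y div 2)) * x"
  obtains v where "\<And>u. u \<in> H \<Longrightarrow> adjacent (x, y) u \<Longrightarrow> u = v"
proof -
  let ?s = "turn (nat (y div 2))" and ?cells = "snake_cells (Suc n)"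
  have s: "?s = 1 \<or> ?s = - 1" by (rule turn_cases)
  have low: "u = (x, y - 1) \<or> u = (x - ?s, y)" if "u \<in> H" "adjacent (x, y) u" for u
  proof -
    obtain a b where u: "u = (a, b)" by (cases u)
    have "(a, b) = (0, 0) \<or> \<bar>a\<bar> < b"
      using adjacent_sector[of a b "Suc n" x y] that u assms(1,3) by auto
    then show ?thesis
    proof
      assume "(a, b) = (0, 0)"
      then show ?thesis using that(2) assms(3) u by (auto simp: adjacent_def)
    next
      assume "\<bar>a\<bar> < b"
      then have "b < y \<or> b = y \<and> ?s * a \<le> ?s * x" using max that(1) u by blast
      then show ?thesis using adjacent_cases[OF that(2)] s u by auto
    qed
  qed
  show thesis
  proof (cases "(x, y - 1) \<in> ?cells")
    case True
    have "(x - ?s, y) \<notin> ?cells"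
      using lower_neighbours_unique[of "Suc n" x y] True assms by auto
    then show thesis using that[of "(x, y - 1)"] low assms(1) by blast
  next
    case False
    then show thesis using that[of "(x - ?s, y)"] low assms(1) by blast
  qed
qed

lemma top_sector_extreme:
  assumes "finite H" "(a, b) \<in> H" "\<bar>a\<bar> < b"
  obtains x y where "(x, y) \<in> H" "\<bar>x\<bar> < y"
    "\<And>x' y'. (x', y') \<in> H \<Longrightarrow> \<bar>x'\<bar> < y' \<Longrightarrow>
      y' < y \<or> y' = y \<and> turn (nat (y div 2)) * x' \<le> turn (nat (y div 2)) * x"
proof -
  define T where "T = {(x, y) \<in> H. \<bar>x\<bar> < y}"
  have T: "finite T" "T \<noteq> {}" using assms by (auto simp: T_def intro: finite_subset[of _ H])
  define y where "y = Max (snd ` T)"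
  have y: "y \<in> snd ` T" "\<And>p. p \<in> T \<Longrightarrow> snd p \<le> y"
    using T by (auto simp: y_def)
  define R where "R = {x. (x, y) \<in> T}"
  have "R \<subseteq> fst ` T" by (force simp: R_def)
  then have R: "finite R" "R \<noteq> {}" using T y(1) by (auto simp: R_def finite_subset)
  let ?s = "turn (nat (y div 2))"
  define m where "m = Max ((*) ?s ` R)"
  have "m \<in> (*) ?s ` R"
    unfolding m_def using R by (intro Max_in) auto
  moreover have "?s * x \<le> m" if "x \<in> R" for x
    unfolding m_def using R that by (intro Max_ge) auto
  ultimately obtain x where x: "x \<in> R" "\<And>x'. x' \<in> R \<Longrightarrow> ?s * x' \<le> ?s * x" by auto
  show thesis
  proof (rule that[of x y])
    show "(x, y) \<in> H" "\<bar>x\<bar> < y" using x(1) by (auto simp: R_def T_def)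
    fix x' y' assume "(x', y') \<in> H" "\<bar>x'\<bar> < y'"
    then have "(x', y') \<in> T" by (simp add: T_def)
    then show "y' < y \<or> y' = y \<and> ?s * x' \<le> ?s * x"
      using y(2)[of "(x', y')"] x(2)[of x'] by (auto simp: R_def)
  qed
qed

text \<open>
  The outermost cell of the cover has one neighbour in the cover and so meets the rest of the cover in
  one point.  Hence the part of \<open>C\<close> in this cell is connected, contains an exit and a second point.
\<close>

lemma plump_if_cover_meets_top:
  assumes "connected C" and H: "irredundant_cover n H C"
    and single: "\<And>c. \<not> C \<subseteq> pieces n {c}" and "(a, b) \<in> H" "\<bar>a\<bar> < b"
  shows "plump n C"
proof -
  have H': "H \<subseteq> snake_cells (Suc n)" "C \<subseteq> pieces n H" "\<And>c. c \<in> H \<Longrightarrow> \<not> C \<subseteq> pieces n (H - {c})"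
    using H unfolding irredundant_cover_def by blast+
  have fin: "finite H" using H'(1) finite_snake_cells[of "Suc n"] finite_subset by auto
  obtain x y where xy: "(x, y) \<in> H" "\<bar>x\<bar> < y" and max: "\<And>x' y'. (x', y') \<in> H \<Longrightarrow> \<bar>x'\<bar> < y' \<Longrightarrow>
      y' < y \<or> y' = y \<and> turn (nat (y div 2)) * x' \<le> turn (nat (y div 2)) * x"
    by (rule top_sector_extreme[OF fin assms(4,5)]) blast
  \<comment> \<open>\<open>v\<close> need not be white: it only names the place where the neighbour would be.\<close>
  obtain v where v: "\<And>u. u \<in> H \<Longrightarrow> adjacent (x, y) u \<Longrightarrow> u = v"
    by (rule extreme_cell_one_neighbour[OF H'(1) xy max]) blast+
  define c where "c = (x, y)"
  define p where "p = emb n c (half (v - c))"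
  let ?A = "pieces n {c}" and ?B = "pieces n (H - {c})"
  have meet: "u = half (v - c) \<and> half (v - c) \<in> exits"
    if "d \<in> H - {c}" "emb n c u = emb n d u'" "u \<in> fractal (Suc n)" "u' \<in> fractal (Suc n)" for d u u'
  proof -
    have "adjacent c d" "u = half (d - c)" using fractal_cells_meet[of n c u d u'] that by auto
    moreover from this have "d = v" using v that(1) by (auto simp: c_def)
    ultimately show ?thesis using adjacent_half_exits by blast
  qed
  have cover: "C \<subseteq> ?A \<union> ?B" using H'(2) xy(1) by (simp add: c_def insert_absorb flip: pieces_Un)
  have not_B: "\<not> C \<subseteq> ?B" using H'(3) xy(1) by (simp add: c_def)
  have cut: "p \<in> C \<inter> ?A \<inter> ?B \<and> connected (C \<inter> ?A)"
  proof (rule connected_cut[OF assms(1) cover])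
    show "closed ?A" "closed ?B" using closed_pieces fin by auto
    show "?A \<inter> ?B \<subseteq> {p}"
    proof
      fix z assume "z \<in> ?A \<inter> ?B"
      then obtain d u u' where "d \<in> H - {c}" "z = emb n c u" "z = emb n d u'"
        "u \<in> fractal (Suc n)" "u' \<in> fractal (Suc n)"
        unfolding pieces_def by blast
      then show "z \<in> {p}" using meet[of d u u'] by (simp add: p_def)
    qed
    show "C \<inter> ?A \<noteq> {}" using cover not_B by blast
    show "C \<inter> ?B \<noteq> {}" using cover single[of c] by blast
  qed
  obtain d u u' where u: "d \<in> H - {c}" "p = emb n c u" "p = emb n d u'"
      "u \<in> fractal (Suc n)" "u' \<in> fractal (Suc n)"
    using cut unfolding pieces_def by blast
  then have e: "u \<in> exits \<inter> zoom n c C" using meet[of d u u'] cut by (auto simp: zoom_def)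
  obtain q where q: "q \<in> C" "q \<notin> ?B" using not_B by blast
  then have "q \<in> ?A" using cover by blast
  then obtain w where w: "q = emb n c w" "w \<in> zoom n c C"
    using q(1) by (auto simp: pieces_def zoom_def)
  have "w \<noteq> u" using w(1) u(2) q cut by blast
  then have "plump (Suc n) (zoom n c C)"
    using exit_plump[OF connected_zoom zoom_subset e w(2)] cut by blast
  then show ?thesis by (rule plump_zoom)
qed

lemma pieces_rot: "pieces n (rotate_90 ` H) = rot ` pieces n H"
proof -
  have "rot ` fractal (Suc n) = fractal (Suc n)"
  proof
    show "rot ` fractal (Suc n) \<subseteq> fractal (Suc n)" using rot_fractal by blast
    show "fractal (Suc n) \<subseteq> rot ` fractal (Suc n)"
    proof
      fix z assume "z \<in> fractal (Suc n)"
      then have "rot (rot (rot z)) \<in> fractal (Suc n)" using rot_fractal by blast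
      moreover have "z = rot (rot (rot (rot z)))" by (simp add: rot_def)
      ultimately show "z \<in> rot ` fractal (Suc n)" by blast
    qed
  qed
  then have "emb n (rotate_90 c) ` fractal (Suc n) = rot ` emb n c ` fractal (Suc n)" for c
    by (simp add: image_image rot_emb flip: image_image[of "emb n (rotate_90 c)" rot])
  then show ?thesis by (simp add: pieces_def image_UN)
qed

lemma inj_rotate_90: "inj rotate_90"
  by (auto simp: inj_def rotate_90_def prod_eq_iff)

lemma inj_rot: "inj rot"
  by (auto simp: inj_def rot_def prod_eq_iff)

lemma irredundant_cover_rot:
  assumes "irredundant_cover n H C"
  shows "irredundant_cover n (rotate_90 ` H) (rot ` C)"
proof -
  have "\<not> rot ` C \<subseteq> pieces n (rotate_90 ` H - {rotate_90 c})" if "c \<in> H" for c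
  proof -
    have "rotate_90 ` H - {rotate_90 c} = rotate_90 ` (H - {c})"
      using inj_rotate_90 by (simp add: image_set_diff)
    then show ?thesis
      using assms that inj_image_subset_iff[OF inj_rot] unfolding irredundant_cover_def by (simp add: pieces_rot)
  qed
  then show ?thesis
    using assms rotate_90_snake_cells unfolding irredundant_cover_def
    by (auto simp: pieces_rot image_mono)
qed

text \<open>
  The cover contains a cell other than the central one, and at most three rotations bring it to the
  top sector.
\<close>

lemma plump_if_not_single_piece:
  assumes "connected C" "C \<subseteq> fractal n" and single: "\<And>c. \<not> C \<subseteq> pieces n {c}"
  shows "plump n C"
proof -
  define Q where "Q = (\<lambda>H C. connected C \<and> irredundant_cover n H C \<and> (\<forall>c. \<not> C \<subseteq> pieces n {c}))"
  have rotQ: "Q (rotate_90 ` H) (rot ` C)" if "Q H C" for H C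
  proof -
    have "\<not> rot ` C \<subseteq> pieces n {c}" for c
    proof -
      have "c = rotate_90 (snd c, - fst c)" by (simp add: rotate_90_def)
      then have "pieces n {c} = rot ` pieces n {(snd c, - fst c)}" using pieces_rot[of n "{(snd c, - fst c)}"] by simp
      then show ?thesis using that inj_image_subset_iff[OF inj_rot] unfolding Q_def by simp
    qed
    then show ?thesis using that connected_rot irredundant_cover_rot unfolding Q_def by blast
  qed
  have top: "plump n C" if "Q H C" "(x, y) \<in> H" "\<bar>x\<bar> < y" for H C x y
    using plump_if_cover_meets_top[of C n H] that unfolding Q_def by blast
  have mem: "(- y, x) \<in> rotate_90 ` H" if "(x, y) \<in> H" for x y H
    using that by (force simp: rotate_90_def)
  have right: "plump n C" if "Q H C" "(x, y) \<in> H" "\<bar>y\<bar> < x" for H C x y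
    by (rule plump_rot[OF top[OF rotQ[OF that(1)] mem[OF that(2)]]]) (use that(3) in simp)
  have bottom: "plump n C" if "Q H C" "(x, y) \<in> H" "\<bar>x\<bar> < - y" for H C x y
    by (rule plump_rot[OF right[OF rotQ[OF that(1)] mem[OF that(2)]]]) (use that(3) in simp)
  have left: "plump n C" if "Q H C" "(x, y) \<in> H" "\<bar>y\<bar> < - x" for H C x y
    by (rule plump_rot[OF bottom[OF rotQ[OF that(1)] mem[OF that(2)]]]) (use that(3) in simp)
  obtain H where H: "irredundant_cover n H C" using irredundant_cover_exists assms(2) by blast
  then have Q: "Q H C" using assms unfolding Q_def by blast
  have "\<not> H \<subseteq> {(0, 0)}"
  proof
    assume "H \<subseteq> {(0, 0)}"
    then have "pieces n H \<subseteq> pieces n {(0, 0)}" by (rule pieces_mono)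
    then show False using H single unfolding irredundant_cover_def by blast
  qed
  then obtain x y where xy: "(x, y) \<in> H" "(x, y) \<noteq> (0, 0)" by (metis subrelI singletonI)
  then have "(x, y) \<in> snake_cells (Suc n)" using H unfolding irredundant_cover_def by blast
  then have "\<bar>x\<bar> < y \<or> \<bar>x\<bar> < - y \<or> \<bar>y\<bar> < x \<or> \<bar>y\<bar> < - x"
    using snake_cells_sector[of x y "Suc n"] xy(2) by auto
  then show ?thesis using top right bottom left Q xy(1) by blast
qed

lemma connected_plump:
  assumes "connected C" "C \<subseteq> fractal n" "p \<in> C" "q \<in> C" "p \<noteq> q"
  shows "plump n C"
proof -
  obtain t where "2 / 2 ^ t < dist p q"
    using obtain_power_less[of "dist p q"] assms(5) by auto
  then show ?thesis using assms(1-4)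
  proof (induction t arbitrary: n C p q)
    case 0
    then have "dist p q \<le> 2" using fractal_dist_le by blast
    then show ?case using 0 by simp
  next
    case (Suc t)
    show ?case
    proof (cases "\<exists>c. C \<subseteq> pieces n {c}")
      case True
      then obtain c where c: "C \<subseteq> pieces n {c}" ..
      obtain v w where "v \<in> zoom n c C" "w \<in> zoom n c C" "2 / 2 ^ t < dist v w"
        using zoom_dist[OF c Suc.prems(4,5,1)] by blast
      then have "plump (Suc n) (zoom n c C)"
        using Suc.IH[OF _ connected_zoom_whole[OF Suc.prems(2) c] zoom_subset] by blast
      then show ?thesis by (rule plump_zoom)
    next
      case False
      then show ?thesis using plump_if_not_single_piece Suc.prems by blast
    qed
  qed
qed

section \<open>The limit set in centred coordinates\<close>

lemma square_inject:
  assumes "square x y q = square x' y' q'" "q > 0" "q' > 0"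
  shows "x = x'" "y = y'" "q = q'"
proof -
  have "x = x' \<and> x + q = x' + q'" "y = y' \<and> y + q = y' + q'"
    using assms unfolding square_def times_eq_iff by (auto simp: Icc_eq_Icc)
  then show "x = x'" "y = y'" "q = q'" by auto
qed

lemma square_map_rectangle:
  assumes "q > 0"
  shows "square_map x y q ` ({s..t} \<times> {u..v}) = {q * s + x..q * t + x} \<times> {q * u + y..q * v + y}"
proof
  show "square_map x y q ` ({s..t} \<times> {u..v}) \<subseteq> {q * s + x..q * t + x} \<times> {q * u + y..q * v + y}"
    using assms by (auto simp: square_map_def)
  show "{q * s + x..q * t + x} \<times> {q * u + y..q * v + y} \<subseteq> square_map x y q ` ({s..t} \<times> {u..v})"
  proof
    fix z assume z: "z \<in> {q * s + x..q * t + x} \<times> {q * u + y..q * v + y}"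
    have "z = square_map x y q ((fst z - x) / q, (snd z - y) / q)"
      using assms by (simp add: square_map_def)
    moreover have "((fst z - x) / q, (snd z - y) / q) \<in> {s..t} \<times> {u..v}"
      using z assms by (cases z) (auto simp: field_simps)
    ultimately show "z \<in> square_map x y q ` ({s..t} \<times> {u..v})" by blast
  qed
qed

text \<open>
  White squares are built by refining the squares of the last level, whereas \<open>approx\<close> places smaller
  copies in the cells of the first pattern.  To reconcile the two orders of composition, the
  induction carries the fact that the similarity onto a white square of level \<open>d\<close> maps every
  approximation of \<open>fractal d\<close> into an approximation of \<open>fractal 0\<close>.
\<close>

lemma white_square_approx:
  assumes "Q \<in> white_squares snake_cross d"
  shows "\<exists>a b q. q > 0 \<and> Q = square (a - q / 2) (b - q / 2) q \<and>
    (\<forall>e. \<forall>w\<in>approx e d. (a - 1/2, b - 1/2) + q *\<^sub>R w \<in> approx (e + d) 0)"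
  using assms
proof (induction d arbitrary: Q)
  case 0
  then show ?case by (intro exI[of _ "1/2"] exI[of _ 1]) (auto simp: zero_prod_def[symmetric])
next
  case (Suc d)
  then obtain x y q0 W where Q: "Q = square_map x y q0 ` W" "q0 > 0" "square x y q0 \<in> white_squares snake_cross d"
    "W \<in> snake_cross (Suc d)" by auto
  obtain a b q where q: "q > 0" "square x y q0 = square (a - q / 2) (b - q / 2) q"
    and sub: "\<And>e w. w \<in> approx e d \<Longrightarrow> (a - 1/2, b - 1/2) + q *\<^sub>R w \<in> approx (e + d) 0"
    using Suc.IH[OF Q(3)] by blast
  have xy: "x = a - q / 2" "y = b - q / 2" "q0 = q" using square_inject[OF q(2) Q(2) q(1)] by auto
  obtain i j where ij: "(i, j) \<in> snake_cells (Suc d)"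
    and W: "W = cell (2 * int (Suc d) + 3 + i) (2 * int (Suc d) + 3 + j) (4 * Suc d + 7)"
    using Q(4) unfolding snake_cross_def by blast
  define m where "m = 4 * real d + 11"
  have m: "m > 0" by (simp add: m_def)
  define q' where "q' = q / m"
  define a' where "a' = a + q * of_int i / m"
  define b' where "b' = b + q * of_int j / m"
  have coord: "q * ((2 * real d + 5 + t) / m) + (z - q / 2) = z + q * t / m - q' / 2"
    "q * ((2 * real d + 6 + t) / m) + (z - q / 2) = z + q * t / m + q' / 2" for t z
    using m by (simp_all add: q'_def divide_simps) (simp_all add: m_def algebra_simps)
  have shift: "t - q' / 2 + q' = t + q' / 2" for t
    by simp
  have W': "W = {(2 * real d + 5 + of_int i) / m..(2 * real d + 6 + of_int i) / m} \<times>
      {(2 * real d + 5 + of_int j) / m..(2 * real d + 6 + of_int j) / m}"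
    by (simp add: W cell_def m_def algebra_simps)
  have "Q = square (a' - q' / 2) (b' - q' / 2) q'"
    unfolding Q(1) W' xy square_map_rectangle[OF q(1)] coord square_def a'_def b'_def shift ..
  moreover have "(a' - 1/2, b' - 1/2) + q' *\<^sub>R w \<in> approx (e + Suc d) 0" if w: "w \<in> approx e (Suc d)" for e w
  proof -
    have "emb d (i, j) w \<in> approx (Suc e) d" using ij w by auto
    then have "(a - 1/2, b - 1/2) + q *\<^sub>R emb d (i, j) w \<in> approx (Suc e + d) 0" by (rule sub)
    moreover have "(a - 1/2, b - 1/2) + q *\<^sub>R emb d (i, j) w = (a' - 1/2, b' - 1/2) + q' *\<^sub>R w"
      by (simp add: prod_eq_iff fst_emb snd_emb a'_def b'_def q'_def m_def add_divide_distrib algebra_simps)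
    ultimately show ?thesis by simp
  qed
  moreover have "q' > 0" using q(1) m by (simp add: q'_def)
  ultimately show ?case by blast
qed

lemma limit_set_centred:
  assumes "z \<in> limit_set snake_cross"
  shows "z - (1/2, 1/2) \<in> fractal 0"
proof -
  \<comment> \<open>The limit set is the intersection over the levels from 1 on.\<close>
  have "z - (1/2, 1/2) \<in> approx d 0" if "d \<ge> 1" for d
  proof -
    obtain Q where Q: "Q \<in> white_squares snake_cross d" "z \<in> Q"
      using assms \<open>d \<ge> 1\<close> unfolding limit_set_def by auto
    obtain a b q where q: "q > 0" "Q = square (a - q / 2) (b - q / 2) q"
      and sub: "\<And>e w. w \<in> approx e d \<Longrightarrow> (a - 1/2, b - 1/2) + q *\<^sub>R w \<in> approx (e + d) 0"
      using white_square_approx[OF Q(1)] by blast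
    define w where "w = ((fst z - a) / q, (snd z - b) / q)"
    have "w \<in> approx 0 d"
      using Q(2) q by (auto simp: square_def w_def unit_box_def field_simps)
    then have "(a - 1/2, b - 1/2) + q *\<^sub>R w \<in> approx d 0" using sub[of w 0] by simp
    moreover have "(a - 1/2, b - 1/2) + q *\<^sub>R w = z - (1/2, 1/2)"
      using q(1) by (simp add: w_def prod_eq_iff)
    ultimately show ?thesis by simp
  qed
  then have "z - (1/2, 1/2) \<in> approx (Suc d) 0" for d by (simp only: le_add1 Suc_eq_plus1_left)
  then show ?thesis unfolding fractal_def using approx_Suc_subset by blast
qed

section \<open>Box counting\<close>

lemma unit_interval_grid:
  assumes "0 \<le> t" "t \<le> (1::real)" "N \<ge> 1"
  obtains i where "i < N" "real i / real N \<le> t" "t \<le> (real i + 1) / real N"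
proof (cases "t = 1")
  case True
  then show thesis using that[of "N - 1"] assms(3) by (simp add: of_nat_diff)
next
  case False
  let ?i = "nat \<lfloor>t * real N\<rfloor>"
  have N: "real N > 0" using assms(3) by simp
  have "t * real N < 1 * real N" using False assms N by (intro mult_strict_right_mono) auto
  then have "?i < N" using assms(1) N by (simp add: nat_less_iff floor_less_iff)
  moreover have "real ?i \<le> t * real N" "t * real N \<le> real ?i + 1"
    using assms(1) N by (auto simp: of_nat_nat)
  ultimately show thesis using that[of ?i] N by (simp add: field_simps)
qed

lemma unit_square_cover:
  assumes "F \<subseteq> {0..1::real} \<times> {0..1::real}" "N \<ge> 1" "2 / real N \<le> \<delta>"
  shows "\<exists>C. finite C \<and> card C \<le> N\<^sup>2 \<and> F \<subseteq> \<Union>C \<and> (\<forall>U\<in>C. bounded U \<and> diameter U \<le> \<delta>)"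
proof -
  define I where "I i = {real i / real N..(real i + 1) / real N}" for i
  define C where "C = (\<lambda>(i, j). I i \<times> I j) ` ({..<N} \<times> {..<N})"
  have "card C \<le> N\<^sup>2"
    unfolding C_def by (rule order_trans[OF card_image_le]) (auto simp: power2_eq_square)
  moreover have "F \<subseteq> \<Union>C"
  proof
    fix p assume "p \<in> F"
    then have p: "0 \<le> fst p" "fst p \<le> 1" "0 \<le> snd p" "snd p \<le> 1" using assms(1) by auto
    obtain i where "i < N" "fst p \<in> I i"
      using unit_interval_grid[OF p(1,2) assms(2)] by (auto simp: I_def)
    moreover obtain j where "j < N" "snd p \<in> I j"
      using unit_interval_grid[OF p(3,4) assms(2)] by (auto simp: I_def)
    ultimately show "p \<in> \<Union>C" unfolding C_def by (intro UnionI[of "I i \<times> I j"]) (auto simp: mem_Times_iff)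
  qed
  moreover have "bounded U \<and> diameter U \<le> \<delta>" if "U \<in> C" for U
  proof
    obtain i j where U: "U = I i \<times> I j" using \<open>U \<in> C\<close> by (auto simp: C_def)
    show "bounded U" unfolding U I_def by (intro bounded_Times) auto
    show "diameter U \<le> \<delta>"
    proof (rule diameter_le)
      have "2 / real N \<ge> 0" by simp
      then show "U \<noteq> {} \<or> 0 \<le> \<delta>" using assms(3) by linarith
      fix p q assume "p \<in> U" "q \<in> U"
      then have pq: "fst p \<in> I i" "fst q \<in> I i" "snd p \<in> I j" "snd q \<in> I j" by (auto simp: U)
      have len: "\<bar>x - y\<bar> \<le> 1 / real N" if "x \<in> I i" "y \<in> I i" for x y i
        using that by (auto simp: I_def add_divide_distrib abs_le_iff)
      have "norm (p - q) \<le> \<bar>fst p - fst q\<bar> + \<bar>snd p - snd q\<bar>"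
        unfolding norm_prod_def by (rule order_trans[OF sqrt_sum_squares_le_sum]) auto
      also have "\<dots> \<le> 2 / real N" using len[OF pq(1,2)] len[OF pq(3,4)] by simp
      finally show "norm (p - q) \<le> \<delta>" using assms(3) by linarith
    qed
  qed
  moreover have "finite C" by (simp add: C_def)
  ultimately show ?thesis by blast
qed

lemma covering_number_le:
  assumes "F \<subseteq> {0..1::real} \<times> {0..1::real}" "0 < \<delta>" "\<delta> \<le> 1"
  shows "real (covering_number \<delta> F) \<le> (3 / \<delta>)\<^sup>2"
proof -
  define N where "N = nat \<lceil>2 / \<delta>\<rceil>"
  have pos: "2 / \<delta> > 0" using assms by simp
  then have N: "2 / \<delta> \<le> real N" "real N \<le> 2 / \<delta> + 1" unfolding N_def by linarith+
  then have "N \<ge> 1" using pos by (cases N) auto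
  have "2 / real N \<le> \<delta>" using N(1) assms(2) \<open>N \<ge> 1\<close> by (simp add: field_simps)
  then obtain C where C: "finite C" "card C \<le> N\<^sup>2" "F \<subseteq> \<Union>C" "\<forall>U\<in>C. bounded U \<and> diameter U \<le> \<delta>"
    using unit_square_cover[OF assms(1) \<open>N \<ge> 1\<close>] by blast
  have "covering_number \<delta> F \<le> card C"
    unfolding covering_number_def by (rule Least_le) (use C in blast)
  then have "real (covering_number \<delta> F) \<le> real N ^ 2"
    using C(2) by (metis le_trans of_nat_le_iff of_nat_power)
  also have "real N \<le> 3 / \<delta>"
  proof -
    have "1 \<le> 1 / \<delta>" using assms by simp
    moreover have "3 / \<delta> = 2 / \<delta> + 1 / \<delta>" by (simp add: add_divide_distrib[symmetric])
    ultimately show ?thesis using N(2) by linarith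
  qed
  then have "real N ^ 2 \<le> (3 / \<delta>)\<^sup>2" by (intro power_mono) auto
  finally show ?thesis .
qed

lemma covering_number_ge:
  assumes "separated \<epsilon> K F" "\<delta> < \<epsilon>" "F \<subseteq> {0..1::real} \<times> {0..1::real}" "0 < \<delta>"
  shows "K \<le> covering_number \<delta> F"
proof -
  obtain X where X: "X \<subseteq> F" "finite X" "card X = K" "\<And>p q. p \<in> X \<Longrightarrow> q \<in> X \<Longrightarrow> p \<noteq> q \<Longrightarrow> \<epsilon> \<le> dist p q"
    using assms(1) unfolding separated_def by blast
  define P where "P = (\<lambda>n. \<exists>C. finite C \<and> card C = n \<and> F \<subseteq> \<Union>C \<and> (\<forall>U\<in>C. bounded U \<and> diameter U \<le> \<delta>))"
  obtain N :: nat where N: "2 / \<delta> \<le> real N" using real_arch_simple by blast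
  have "2 / \<delta> > 0" using assms(4) by simp
  then have "N \<ge> 1" using N by (cases N) auto
  have "2 / real N \<le> \<delta>" using N assms(4) \<open>N \<ge> 1\<close> by (simp add: field_simps)
  then obtain C where "finite C" "F \<subseteq> \<Union>C" "\<forall>U\<in>C. bounded U \<and> diameter U \<le> \<delta>"
    using unit_square_cover[OF assms(3) \<open>N \<ge> 1\<close>] by metis
  then have "P (card C)" unfolding P_def by (intro exI[of _ C]) simp
  then have "\<exists>n. P n" ..
  then have "P (covering_number \<delta> F)"
    unfolding covering_number_def P_def by (rule LeastI_ex)
  then obtain C where C: "finite C" "card C = covering_number \<delta> F" "F \<subseteq> \<Union>C"
    "\<forall>U\<in>C. bounded U \<and> diameter U \<le> \<delta>" unfolding P_def by blast
  have "\<forall>p\<in>X. \<exists>U\<in>C. p \<in> U" using X(1) C(3) by blast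
  then obtain u where u: "\<And>p. p \<in> X \<Longrightarrow> u p \<in> C \<and> p \<in> u p" by metis
  have "inj_on u X"
  proof (rule inj_onI, rule ccontr)
    fix p q assume pq: "p \<in> X" "q \<in> X" "u p = u q" "p \<noteq> q"
    then have "p \<in> u p" "q \<in> u p" "bounded (u p)" using u[of p] u[of q] C(4) by auto
    then have "dist p q \<le> diameter (u p)" by (intro diameter_bounded_bound)
    also have "\<dots> \<le> \<delta>" using u C(4) pq(1) by blast
    finally show False using X(4)[OF pq(1,2,4)] assms(2) by linarith
  qed
  then have "card X \<le> card C" using u C(1) by (intro card_inj_on_le[of u]) auto
  then show ?thesis using X(3) C(2) by simp
qed

text \<open>
  The weak form \<open>fact n \<ge> (n / exp 1) ^ n\<close> of Stirling's formula, in logarithmic form.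
\<close>

lemma ln_fact_ge: "n \<ge> 1 \<Longrightarrow> ln (fact n :: real) \<ge> real n * ln (real n) - real n"
proof (induction n rule: dec_induct)
  case base
  then show ?case by simp
next
  case (step n)
  have n: "real n > 0" using step by simp
  have "real (Suc n) = real n * (1 + 1 / real n)"
    using n by (simp add: distrib_left)
  then have "ln (real (Suc n)) = ln (real n) + ln (1 + 1 / real n)"
    using n by (simp only: ln_mult_pos add_pos_pos zero_less_one zero_less_divide_1_iff)
  also have "\<dots> \<le> ln (real n) + 1 / real n" using n ln_add_one_self_le_self[of "1 / real n"] by simp
  finally have "real n * ln (real (Suc n)) \<le> real n * (ln (real n) + 1 / real n)"
    using n by (intro mult_left_mono) auto
  then have "real n * ln (real (Suc n)) \<le> real n * ln (real n) + 1"
    using n by (simp add: distrib_left)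
  moreover have "ln (fact (Suc n) :: real) = ln (real (Suc n)) + ln (fact n)"
    unfolding fact_Suc of_nat_mult by (subst ln_mult_pos) auto
  moreover have "real (Suc n) * ln (real (Suc n)) = real n * ln (real (Suc n)) + ln (real (Suc n))"
    by (simp add: distrib_right)
  ultimately show ?case using step.IH by simp
qed

lemma mesh_ge: "1 / mesh 0 n \<le> 11 ^ n * fact n"
proof (induction n)
  case 0
  then show ?case by (simp add: mesh_def)
next
  case (Suc n)
  have "1 / mesh 0 (Suc n) = 1 / mesh 0 n * (4 * real n + 11)" by (simp add: mesh_def)
  also have "\<dots> \<le> (11 ^ n * fact n) * (11 * (real n + 1))"
    using Suc mesh_pos[of 0 n] by (intro mult_mono) auto
  also have "\<dots> = 11 ^ Suc n * fact (Suc n)" by (simp add: algebra_simps)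
  finally show ?case .
qed

lemma mesh_le: "mesh 0 n \<le> (1/11) ^ n"
proof (induction n)
  case 0
  then show ?case by (simp add: mesh_def)
next
  case (Suc n)
  have "mesh 0 (Suc n) = mesh 0 n * (1 / (4 * real n + 11))" by (simp add: mesh_def)
  also have "\<dots> \<le> (1/11) ^ n * (1/11)"
    using Suc mesh_pos[of 0 n] by (intro mult_mono divide_left_mono) auto
  finally show ?case by simp
qed

lemma mesh_antimono: "d \<le> e \<Longrightarrow> mesh n e \<le> mesh n d"
proof (rule lift_Suc_antimono_le[of "mesh n"])
  fix d show "mesh n (Suc d) \<le> mesh n d"
  proof -
    have "mesh n (Suc d) = mesh n d * (1 / (4 * real (n + d) + 11))" by (simp add: mesh_def)
    also have "\<dots> \<le> mesh n d" using mesh_pos[of n d] by (intro mult_left_le) auto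
    finally show ?thesis .
  qed
qed

lemma mesh_scale:
  assumes "0 < \<delta>" "\<delta> < mesh 0 n\<^sub>0"
  obtains n where "n \<ge> n\<^sub>0" "mesh 0 (Suc n) \<le> \<delta>" "\<delta> < mesh 0 n"
proof -
  obtain k where "(1/11) ^ k < \<delta>" using real_arch_pow_inv[OF assms(1), of "1/11"] by auto
  then have ex: "mesh 0 k \<le> \<delta>" using mesh_le[of k] by linarith
  define m where "m = (LEAST k. mesh 0 k \<le> \<delta>)"
  have m: "mesh 0 m \<le> \<delta>" unfolding m_def by (rule LeastI[of _ k]) (rule ex)
  have "n\<^sub>0 < m"
  proof (rule ccontr)
    assume "\<not> n\<^sub>0 < m"
    then show False using mesh_antimono[of m n\<^sub>0 0] m assms(2) by simp
  qed
  then obtain n where n: "m = Suc n" "n \<ge> n\<^sub>0" by (cases m) auto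
  then have "\<not> mesh 0 n \<le> \<delta>" using not_less_Least[of n "\<lambda>k. mesh 0 k \<le> \<delta>"] by (simp add: m_def)
  then show thesis using that[of n] n m by simp
qed

lemma fact_prod: "fact j * (\<Prod>i<d. Suc j + i) = fact (j + d)"
  by (induction d) (simp_all add: algebra_simps)

text \<open>
  For \<open>\<delta>\<close> between two consecutive mesh sizes, the lower bound on the covering number comes from the
  larger mesh size and the bound on \<open>- ln \<delta>\<close> from the smaller one.  Both bounds are
  expressed through \<open>ln (fact (n + 1))\<close>, whose coefficients are 2 and 1; the remaining terms are of
  the order of \<open>n\<close>, hence negligible against \<open>n * ln n\<close>.
\<close>

lemma has_box_dim_2:
  assumes F: "F \<subseteq> {0..1::real} \<times> {0..1::real}" and j: "j \<ge> 1"
    and sep: "\<And>d. separated (mesh 0 (j + d)) (\<Prod>i<d. (j + i)\<^sup>2) F"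
  shows "has_box_dim F 2"
proof -
  define N where "N \<delta> = covering_number \<delta> F" for \<delta>
  have N_pos: "N \<delta> \<ge> 1" if "0 < \<delta>" "\<delta> < mesh 0 j" for \<delta>
    using covering_number_ge[OF sep[of 0] _ F] that by (simp add: N_def)
  define c where "c = 2 * ln (fact (j - 1) :: real)"
  \<comment> \<open>A lower bound for the quotient, with \<open>ln (fact n)\<close> in the denominator replaced by
    the lower bound \<open>n * ln n - n\<close>.\<close>
  define h where "h n = 2 - (2 * real n * ln 11 + 4 * ln (real n) + c) / (real n * ln 11 + (real n * ln (real n) - real n))" for n :: nat
  have h_lim: "h \<longlonglongrightarrow> 2"
    unfolding h_def by real_asymp
  have ln11: "ln (11::real) > 1"
  proof -
    have "exp 1 < (11::real)" using exp_le by linarith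
    then have "ln (exp 1) < ln (11::real)" by (subst ln_less_cancel_iff) auto
    then show ?thesis by simp
  qed
  have lower: "a < ln (real (N \<delta>)) / - ln \<delta>"
    if \<delta>: "0 < \<delta>" "\<delta> < mesh 0 n" and n: "n \<ge> j" "mesh 0 (Suc n) \<le> \<delta>" and a: "a < h (Suc n)" "0 \<le> a" for \<delta> a n
  proof -
    let ?k = "Suc n"
    define D where "D = real ?k * ln 11 + ln (fact ?k :: real)"
    have "\<delta> < 1" using \<delta>(2) mesh_le_1[of 0 n] by linarith
    then have "- ln \<delta> > 0" using \<delta>(1) by simp
    have "- ln \<delta> \<le> - ln (mesh 0 ?k)" using n(2) mesh_pos[of 0 ?k] by simp
    also have "\<dots> = ln (1 / mesh 0 ?k)" using mesh_pos[of 0 ?k] by (simp add: ln_div)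
    also have "\<dots> \<le> ln (11 ^ ?k * fact ?k)"
      using mesh_ge[of ?k] mesh_pos[of 0 ?k] by (subst ln_le_cancel_iff) auto
    also have "\<dots> = D" unfolding D_def by (subst ln_mult_pos) (simp_all only: ln_realpow zero_less_power zero_less_numeral fact_gt_zero)
    finally have D: "- ln \<delta> \<le> D" .
    have "fact (j - 1) ^ 2 * (\<Prod>i<n - j. (j + i)\<^sup>2) = (fact (n - 1) :: nat) ^ 2"
    proof -
      have "fact (j - 1) * (\<Prod>i<n - j. j + i) = (fact (n - 1) :: nat)"
        using fact_prod[of "j - 1" "n - j"] j n(1) by simp
      then show ?thesis by (simp flip: power_mult_distrib prod_power_distrib)
    qed
    moreover have "(\<Prod>i<n - j. (j + i)\<^sup>2) \<le> N \<delta>"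
      using covering_number_ge[OF sep[of "n - j"] _ F \<delta>(1)] \<delta>(2) n(1) by (simp add: N_def)
    ultimately have "(fact (n - 1) :: nat) ^ 2 \<le> fact (j - 1) ^ 2 * N \<delta>" by (metis mult_le_mono2)
    then have "real ((fact (n - 1)) ^ 2) \<le> real (fact (j - 1) ^ 2 * N \<delta>)" by (rule of_nat_mono)
    then have le: "(fact (n - 1) :: real) ^ 2 \<le> fact (j - 1) ^ 2 * real (N \<delta>)" by simp
    have "N \<delta> \<ge> 1" using N_pos[OF \<delta>(1)] \<delta>(2) mesh_antimono[OF n(1), of 0] by simp
    then have "real (N \<delta>) > 0" by simp
    have "ln ((fact (n - 1) :: real) ^ 2) \<le> ln (fact (j - 1) ^ 2 * real (N \<delta>))"
      using le \<open>real (N \<delta>) > 0\<close> by (subst ln_le_cancel_iff) auto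
    then have num: "2 * ln (fact (n - 1) :: real) - c \<le> ln (real (N \<delta>))"
      using \<open>real (N \<delta>) > 0\<close> by (simp add: ln_mult_pos ln_realpow c_def)
    have "n \<ge> 1" using j n(1) by simp
    have "(fact ?k :: real) = real ?k * (real n * fact (n - 1))"
      using \<open>n \<ge> 1\<close> fact_reduce[of n] by (simp add: fact_Suc)
    then have "ln (fact ?k :: real) = ln (real ?k) + (ln (real n) + ln (fact (n - 1)))"
      using \<open>n \<ge> 1\<close> by (simp add: ln_mult_pos del: fact_Suc of_nat_Suc)
    moreover have "ln (real n) \<le> ln (real ?k)" using \<open>n \<ge> 1\<close> by simp
    ultimately have num2: "2 * D - (2 * real ?k * ln 11 + 4 * ln (real ?k) + c) \<le> ln (real (N \<delta>))"
      using num unfolding D_def by (simp del: fact_Suc of_nat_Suc)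
    define D' where "D' = real ?k * ln 11 + (real ?k * ln (real ?k) - real ?k)"
    have "D' \<le> D" using ln_fact_ge[of ?k] unfolding D_def D'_def by (simp del: fact_Suc)
    have "D' > 0"
    proof -
      have "0 < r * u + (r * v - r)" if "r > 0" "u > 1" "v \<ge> 0" for r u v :: real
        using mult_strict_left_mono[of 1 u r] mult_nonneg_nonneg[of r v] that by linarith
      then show ?thesis unfolding D'_def using ln11 by simp
    qed
    define E where "E = 2 * real ?k * ln 11 + 4 * ln (real ?k) + c"
    have "E \<ge> 0" unfolding E_def c_def by (intro add_nonneg_nonneg) (auto simp: fact_ge_1)
    have "a < 2 - E / D'" using a(1) by (simp only: h_def D'_def E_def)
    also have "\<dots> \<le> 2 - E / D"
      using \<open>D' \<le> D\<close> \<open>D' > 0\<close> \<open>E \<ge> 0\<close> by (simp add: frac_le)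
    also have "\<dots> = (2 * D - E) / D" using \<open>D' \<le> D\<close> \<open>D' > 0\<close> by (simp add: diff_divide_distrib)
    finally have "a < (2 * D - E) / D" .
    then have "a * D < 2 * D - E" using \<open>D' \<le> D\<close> \<open>D' > 0\<close> by (simp add: less_divide_eq)
    then have "a * D < ln (real (N \<delta>))" using num2 by (simp only: E_def)
    moreover have "a * (- ln \<delta>) \<le> a * D" using D a(2) by (rule mult_left_mono)
    ultimately show ?thesis unfolding pos_less_divide_eq[OF \<open>- ln \<delta> > 0\<close>] by linarith
  qed
  have upper_lim: "((\<lambda>\<delta>::real. 2 * (ln 3 - ln \<delta>) / - ln \<delta>) \<longlongrightarrow> 2) (at_right 0)"
    by real_asymp
  have upper: "ln (real (N \<delta>)) / - ln \<delta> \<le> 2 * (ln 3 - ln \<delta>) / - ln \<delta>" if \<delta>: "0 < \<delta>" "\<delta> < mesh 0 j" for \<delta>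
  proof (rule divide_right_mono)
    have "\<delta> < 1" using \<delta>(2) mesh_le_1[of 0 j] by linarith
    then show "0 \<le> - ln \<delta>" using \<delta>(1) by simp
    have "real (N \<delta>) \<le> (3 / \<delta>)\<^sup>2" using covering_number_le[OF F \<delta>(1)] \<open>\<delta> < 1\<close> by (simp add: N_def)
    then have "ln (real (N \<delta>)) \<le> ln ((3 / \<delta>)\<^sup>2)" using N_pos[OF \<delta>] \<delta>(1) by (subst ln_le_cancel_iff) auto
    also have "\<dots> = 2 * (ln 3 - ln \<delta>)" using \<delta>(1) by (simp add: ln_realpow ln_div)
    finally show "ln (real (N \<delta>)) \<le> 2 * (ln 3 - ln \<delta>)" .
  qed
  have near: "eventually (\<lambda>\<delta>::real. 0 < \<delta> \<and> \<delta> < mesh 0 n) (at_right 0)" for n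
    using mesh_pos[of 0 n] eventually_at_right_real[of 0 "mesh 0 n"] by (auto elim: eventually_mono)
  have "((\<lambda>\<delta>. ln (real (N \<delta>)) / - ln \<delta>) \<longlongrightarrow> 2) (at_right 0)"
  proof (rule order_tendstoI)
    fix a :: real assume "2 < a"
    then have "eventually (\<lambda>\<delta>. 2 * (ln 3 - ln \<delta>) / - ln \<delta> < a) (at_right 0)"
      using order_tendstoD(2)[OF upper_lim] by blast
    with near[of j] show "eventually (\<lambda>\<delta>. ln (real (N \<delta>)) / - ln \<delta> < a) (at_right 0)"
    proof eventually_elim
      case (elim \<delta>)
      then show ?case using upper[of \<delta>] by linarith
    qed
  next
    fix a :: real assume "a < 2"
    define b where "b = max a 0"
    have "b < 2" using \<open>a < 2\<close> by (simp add: b_def)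
    then have "eventually (\<lambda>n. b < h n) sequentially" using order_tendstoD(1)[OF h_lim] by blast
    then obtain n\<^sub>0 where n\<^sub>0: "\<And>n. n \<ge> n\<^sub>0 \<Longrightarrow> b < h n" unfolding eventually_sequentially by blast
    show "eventually (\<lambda>\<delta>. a < ln (real (N \<delta>)) / - ln \<delta>) (at_right 0)"
      using near[of "max n\<^sub>0 j"]
    proof eventually_elim
      case (elim \<delta>)
      then obtain n where n: "n \<ge> max n\<^sub>0 j" "mesh 0 (Suc n) \<le> \<delta>" "\<delta> < mesh 0 n"
        using mesh_scale by blast
      then have "b < ln (real (N \<delta>)) / - ln \<delta>"
        using lower[of \<delta> n b] elim n\<^sub>0[of "Suc n"] by (simp add: b_def)
      then show ?case by (simp add: b_def)
    qed
  qed
  then show ?thesis unfolding has_box_dim_def N_def .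
qed

theorem theorem4:
  fixes x y :: "real \<times> real" and a :: "(real \<times> real) set"
  assumes "x \<in> limit_set snake_cross" and "y \<in> limit_set snake_cross" and "x \<noteq> y"
    and "arc_between (limit_set snake_cross) x y a"
  shows "has_box_dim a 2"
proof -
  obtain g where g: "arc g" "pathstart g = x" "pathfinish g = y" "path_image g = a"
    and sub: "a \<subseteq> limit_set snake_cross"
    using assms(4) unfolding arc_between_def by blast
  define C where "C = (\<lambda>z. z - (1/2, 1/2)) ` a"
  have a_eq: "a = (\<lambda>z. z + (1/2, 1/2)) ` C"
    by (simp add: C_def image_image)
  have C_sub: "C \<subseteq> fractal 0"
    using sub limit_set_centred by (auto simp: C_def)
  have "connected a"
    using connected_path_image[OF arc_imp_path[OF g(1)]] g(4) by simp
  then have "connected C"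
    unfolding C_def by (rule connected_continuous_image[rotated]) (intro continuous_intros)
  moreover have "x \<in> a" "y \<in> a"
    using g pathstart_in_path_image pathfinish_in_path_image by blast+
  ultimately have "plump 0 C"
    using connected_plump[of C 0 "x - (1/2, 1/2)" "y - (1/2, 1/2)"] C_sub assms(3) by (simp add: C_def)
  then obtain j where j: "j \<ge> 1" "\<And>d. separated (mesh 0 (j + d)) (\<Prod>i<d. (j + i)\<^sup>2) C"
    unfolding plump_def by auto
  show ?thesis
  proof (rule has_box_dim_2[OF _ j(1)])
    show "a \<subseteq> {0..1} \<times> {0..1}"
    proof
      fix z assume "z \<in> a"
      then have "z - (1/2, 1/2) \<in> fractal 0" using C_sub by (auto simp: C_def)
      then have "\<bar>fst z - 1/2\<bar> \<le> 1/2" "\<bar>snd z - 1/2\<bar> \<le> 1/2"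
        using fractal_abs_le[of "z - (1/2, 1/2)" 0] by auto
      moreover have "0 \<le> t \<and> t \<le> 1" if "\<bar>t - 1/2\<bar> \<le> 1/2" for t :: real
        using that by linarith
      ultimately show "z \<in> {0..1} \<times> {0..1}"
        by (simp only: mem_Times_iff atLeastAtMost_iff)
    qed
    show "separated (mesh 0 (j + d)) (\<Prod>i<d. (j + i)\<^sup>2) a" for d
      using separated_image[OF j(2)[of d], of 1 "\<lambda>z. z + (1/2, 1/2)"] a_eq by simp
  qed
qed

end
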